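(* A smooth projective tropical variety which admits a quasi-projective triangulation is Kähler. Explicitly: let $Y$ be a unimodular polyhedral complex in $\mathbb R^n$ (with respect to the lattice $\mathbb Z^n$) with smooth support of pure dimension $d$, whose recession pseudo-fan $Y_\infty$ is a fan, and let $X$ be the compactification of $Y$ in the tropical toric variety $\mathbb{TP}_{Y_\infty}$. If $Y$ is quasi-projective, then $X$ is Kähler, i.e. the smooth compact tropical variety $|X|$ admits a unimodular triangulation carrying a Kähler class.
   Context: **Polyhedral complexes.** A polyhedron in $\mathbb R^n$ is a non-empty finite intersection of closed affine half-spaces containing no line; $\delta_\infty$ is its recession cone. A polyhedral complex is a finite non-empty collection of polyhedra closed under faces and meeting along common (possibly empty) faces. A polyhedron is unimodular if it equals $\mathrm{conv}(v_0,\dots,v_k)+\sum_j\mathbb R_+u_j$ with $v_i,u_j\in\mathbb Z^n$ and $(v_1-v_0,\dots,v_k-v_0,u_1,\dots,u_l)$ part of a basis of $\mathbb Z^n$; a complex is unimodular if all its faces are. $Y_\infty=\{\delta_\infty:\delta\in Y\}$. A continuous function $f$ on $|Y|$, affine linear on each face, is strictly convex if for each face $\delta$ there is an affine linear function $\lambda$ on $\mathbb R^n$ such that $f-\lambda$ vanishes on $\delta$ and is strictly positive on $U\setminus\delta$ for some open neighborhood $U$ of the relative interior of $\delta$ in $|Y|$. $Y$ is quasi-projective if it admits a strictly convex function. **Smoothness.** For a simple matroid $\mathfrak M$ on $E$, $\Sigma_{\mathfrak M}\subset\mathbb R^E/\mathbb R(1,\dots,1)$ is the fan of cones generated by $e_{F_1},\dots,e_{F_k}$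 over flags of flats $\emptyset\neq F_1\subsetneq\dots\subsetneq F_k\neq E$, $e_F$ the class of $\sum_{i\in F}e_i$. A Bergman support is a subset of $\mathbb R^n$ for which an integral linear map to some $\mathbb R^E/\mathbb R(1,\dots,1)$ restricts to an isomorphism (a bijection, also identifying lattice points) onto $|\Sigma_{\mathfrak M}|$. $|Y|$ is smooth if near each point it coincides, up to translation, with a neighborhood of $0$ in a Bergman support. **Compactification.** For a unimodular fan $\Delta$, $\mathbb{TP}_\Delta=\bigsqcup_{\sigma\in\Delta}\mathbb R^n/\mathrm{span}(\sigma)$, where the open subset $\bigsqcup_{\tau\preceq\sigma}\mathbb R^n/\mathrm{span}(\tau)$ is identified with the monoid homomorphisms $\sigma^\vee\cap(\mathbb Z^n)^\vee\to(\mathbb R\cup\{\infty\},+)$ with pointwise convergence. $X$ is the extended polyhedral complex induced by $Y$ on the closure of $|Y|$ in $\mathbb{TP}_{Y_\infty}$; $X_{\mathrm f}$ is the set of compact faces of $Y$. **Local Chow rings.** For $\delta\in X_{\mathrm f}$ with tangent space $T\delta$, $\Sigma^\delta$ is the star fan of $\delta$ in $\mathbb R^n/T\delta$ (lattice $\mathbb Z^n/(\mathbb Z^n\cap T\delta)$): its cones are generated by the images of $\eta-\delta$ for $\eta\in Y$, $\eta\supseteq\delta$. $H^2(\delta)=A^1(\Sigma^\delta)$ (real coefficients), where for a unimodular fan $\Sigma$ with primitive ray generators $e_\varrho$, $A^\bullet(\Sigma)=\mathbb R[x_\varrho]/(I_1+I_2)$, $I_1$ generated by the products of variables whose rays do not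 form a cone and $I_2$ by $\sum_\varrho f(e_\varrho)x_\varrho$, $f$ a linear form. A class in $A^1(\Sigma)$ is ample if it equals $\sum_\varrho f(e_\varrho)x_\varrho$ with $f$ a strictly convex cone-wise linear function on $\Sigma$. For a vertex $v$ of an edge $e$ of $X_{\mathrm f}$, $\rho=\rho_{e/v}$ denotes the ray of $\Sigma^v$ determined by $e$, and $i^*_{v\prec e}\colon A^\bullet(\Sigma^v)\to A^\bullet(\Sigma^e)$ is the ring homomorphism with $x_\varrho\mapsto x_\varrho$ if $\varrho\ne\rho$ and $\varrho+\rho$ is a cone, $x_\varrho\mapsto0$ if $\varrho\neq\rho$ and $\varrho+\rho$ is not a cone, and $x_\rho\mapsto-\sum_{\varrho\in\Sigma^e_1}f(e_\varrho)x_\varrho$, where rays of $\Sigma^e$ are identified with the rays $\varrho$ of $\Sigma^v$ such that $\varrho+\rho$ is a two-dimensional cone and $f$ is any linear form with $f(e_\rho)=1$ (evaluated on the generators of these rays in $\Sigma^v$). **Kähler.** A Kähler class for $X$ is the data of ample classes $\ell^v\in H^2(v)$ for all vertices $v\in X_{\mathrm f}$ such that $i^*_{u\prec e}(\ell^u)=i^*_{v\prec e}(\ell^v)$ in $H^2(e)$ for every edge $e$ of $X_{\mathrm f}$ with extremities $u,v$ (such data defines an element of $H^{1,1}_{\mathrm{trop}}(X)$). A smooth compact tropical variety is Kähler if it admits a unimodular triangulation with a Kähler class. *)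

theory Defs
  imports
    "HOL-Analysis.Analysis"
    "HOL-Analysis.Finite_Function_Topology"
    "HOL-Algebra.QuotRing"
begin

text \<open>
  The ambient space is \<open>real ^ 'n\<close> with the lattice of integral vectors; linear forms are
  given by the inner product, which identifies the dual lattice with the lattice.

  Convention for a quotient \<open>V/W\<close> of a real vector space by a subspace: a point is a coset,
  and a subset (cone, ray, support) is represented by its preimage in \<open>V\<close>, i.e. by a
  \<open>W\<close>-invariant subset of \<open>V\<close>.  A linear form on \<open>V/W\<close> is a linear form on \<open>V\<close> vanishing on \<open>W\<close>.
\<close>

definition quot_pt :: "'a::real_vector set \<Rightarrow> 'a \<Rightarrow> 'a set" where
  "quot_pt W x = {x + w | w. w \<in> W}"

definition lattice_pts :: "(real ^ 'n) set" where
  "lattice_pts = {x. \<forall>i. x $ i \<in> \<int>}"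


section \<open>Polyhedral complexes\<close>

definition contains_line :: "(real ^ 'n) set \<Rightarrow> bool" where
  "contains_line P \<longleftrightarrow> (\<exists>x v. v \<noteq> 0 \<and> (\<forall>t::real. x + t *\<^sub>R v \<in> P))"

text \<open>The library predicate \<open>polyhedron\<close> allows the empty set and polyhedra containing lines.\<close>

definition pointed_polyhedron :: "(real ^ 'n) set \<Rightarrow> bool" where
  "pointed_polyhedron P \<longleftrightarrow> polyhedron P \<and> P \<noteq> {} \<and> \<not> contains_line P"

definition polyhedral_complex :: "(real ^ 'n) set set \<Rightarrow> bool" where
  "polyhedral_complex Y \<longleftrightarrow>
     finite Y \<and> Y \<noteq> {} \<and>
     (\<forall>P\<in>Y. pointed_polyhedron P) \<and>
     (\<forall>P\<in>Y. \<forall>F. F face_of P \<and> F \<noteq> {} \<longrightarrow> F \<in> Y) \<and>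
     (\<forall>P\<in>Y. \<forall>Q\<in>Y. (P \<inter> Q) face_of P \<and> (P \<inter> Q) face_of Q)"

definition recession_cone :: "(real ^ 'n) set \<Rightarrow> (real ^ 'n) set" where
  "recession_cone P = {u. \<forall>x\<in>P. \<forall>t\<ge>0. x + t *\<^sub>R u \<in> P}"

definition recession_fan :: "(real ^ 'n) set set \<Rightarrow> (real ^ 'n) set set" where
  "recession_fan Y = recession_cone ` Y"

definition is_fan :: "(real ^ 'n) set set \<Rightarrow> bool" where
  "is_fan \<Delta> \<longleftrightarrow> polyhedral_complex \<Delta> \<and> (\<forall>\<sigma>\<in>\<Delta>. convex_cone \<sigma>)"

definition lattice_basis :: "(real ^ 'n) set \<Rightarrow> bool" where
  "lattice_basis B \<longleftrightarrow>
     finite B \<and> independent B \<and>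
     {\<Sum>b\<in>B. of_int (c b) *\<^sub>R b | c :: real ^ 'n \<Rightarrow> int. True} = lattice_pts"

text \<open>Families are lists, so that \<open>distinct\<close> records that the members are different.\<close>

definition part_of_lattice_basis :: "(real ^ 'n) list \<Rightarrow> bool" where
  "part_of_lattice_basis xs \<longleftrightarrow> distinct xs \<and> (\<exists>B. set xs \<subseteq> B \<and> lattice_basis B)"

definition unimodular_polyhedron :: "(real ^ 'n) set \<Rightarrow> bool" where
  "unimodular_polyhedron P \<longleftrightarrow>
     (\<exists>v0 vs us.
        v0 \<in> lattice_pts \<and> set vs \<subseteq> lattice_pts \<and> set us \<subseteq> lattice_pts \<and>
        part_of_lattice_basis (map (\<lambda>v. v - v0) vs @ us) \<and>
        P = {x + (\<Sum>u\<in>set us. c u *\<^sub>R u) | x c.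
               x \<in> convex hull (insert v0 (set vs)) \<and> (\<forall>u. 0 \<le> (c u :: real))})"

definition unimodular_complex :: "(real ^ 'n) set set \<Rightarrow> bool" where
  "unimodular_complex Y \<longleftrightarrow> polyhedral_complex Y \<and> (\<forall>P\<in>Y. unimodular_polyhedron P)"

definition pure_dimension :: "(real ^ 'n) set set \<Rightarrow> nat \<Rightarrow> bool" where
  "pure_dimension Y d \<longleftrightarrow>
     (\<forall>P\<in>Y. (\<forall>Q\<in>Y. P \<subseteq> Q \<longrightarrow> Q = P) \<longrightarrow> aff_dim P = int d)"

text \<open>
  Also used for fans in \<open>V/W\<close> given by preimages: if \<open>f\<close> is a function on the quotient, so that
  it vanishes on \<open>W\<close>, then each \<open>g\<close> below is zero on \<open>W\<close>, and \<open>U\<close> may be replaced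
  by the \<open>W\<close>-invariant neighbourhood \<open>U + W\<close>.
\<close>

definition strictly_convex :: "(real ^ 'n) set set \<Rightarrow> (real ^ 'n \<Rightarrow> real) \<Rightarrow> bool" where
  "strictly_convex Y f \<longleftrightarrow>
     continuous_on (\<Union>Y) f \<and>
     (\<forall>P\<in>Y. \<exists>a b. \<forall>x\<in>P. f x = a \<bullet> x + b) \<and>
     (\<forall>P\<in>Y. \<exists>a b. let g = (\<lambda>x. a \<bullet> x + b) in
        (\<forall>x\<in>P. f x - g x = 0) \<and>
        (\<exists>U. openin (top_of_set (\<Union>Y)) U \<and> rel_interior P \<subseteq> U \<and>
             (\<forall>x\<in>U - P. f x - g x > 0)))"

definition quasi_projective :: "(real ^ 'n) set set \<Rightarrow> bool" where
  "quasi_projective Y \<longleftrightarrow> (\<exists>f. strictly_convex Y f)"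


section \<open>Matroids, Bergman supports and smoothness\<close>

text \<open>Matroids are given by their independent sets; ground sets are, up to relabelling, finite sets
  of natural numbers.\<close>

definition matroid :: "nat set \<Rightarrow> nat set set \<Rightarrow> bool" where
  "matroid E \<I> \<longleftrightarrow>
     finite E \<and> \<I> \<subseteq> Pow E \<and> {} \<in> \<I> \<and>
     (\<forall>A\<in>\<I>. \<forall>B. B \<subseteq> A \<longrightarrow> B \<in> \<I>) \<and>
     (\<forall>A\<in>\<I>. \<forall>B\<in>\<I>. card A < card B \<longrightarrow> (\<exists>x\<in>B - A. insert x A \<in> \<I>))"

text \<open>No loops and no parallel elements.\<close>

definition simple_matroid :: "nat set \<Rightarrow> nat set set \<Rightarrow> bool" where
  "simple_matroid E \<I> \<longleftrightarrow> matroid E \<I> \<and> (\<forall>x\<in>E. \<forall>y\<in>E. {x, y} \<in> \<I>)"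

definition matroid_rank :: "nat set set \<Rightarrow> nat set \<Rightarrow> nat" where
  "matroid_rank \<I> A = Max (card ` {B \<in> \<I>. B \<subseteq> A})"

definition flat :: "nat set \<Rightarrow> nat set set \<Rightarrow> nat set \<Rightarrow> bool" where
  "flat E \<I> F \<longleftrightarrow>
     F \<subseteq> E \<and> (\<forall>x\<in>E - F. matroid_rank \<I> F < matroid_rank \<I> (insert x F))"

text \<open>For finite \<open>E\<close>, the space of real functions on \<open>E\<close> is realised inside \<open>nat \<Rightarrow>\<^sub>0 real\<close>.\<close>

definition coord_space :: "nat set \<Rightarrow> (nat \<Rightarrow>\<^sub>0 real) set" where
  "coord_space E = {x. Poly_Mapping.keys x \<subseteq> E}"

definition coord_lattice :: "nat set \<Rightarrow> (nat \<Rightarrow>\<^sub>0 real) set" where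
  "coord_lattice E = {x \<in> coord_space E. \<forall>i. Poly_Mapping.lookup x i \<in> \<int>}"

definition char_vec :: "nat set \<Rightarrow> (nat \<Rightarrow>\<^sub>0 real)" where
  "char_vec F = (\<Sum>i\<in>F. Poly_Mapping.single i 1)"

definition bergman_fan_support :: "nat set \<Rightarrow> nat set set \<Rightarrow> (nat \<Rightarrow>\<^sub>0 real) set" where
  "bergman_fan_support E \<I> =
     {(\<Sum>F\<in>C. c F *\<^sub>R char_vec F) + t *\<^sub>R char_vec E | C c t.
        (\<forall>F\<in>C. flat E \<I> F \<and> F \<noteq> {} \<and> F \<noteq> E) \<and>
        (\<forall>F\<in>C. \<forall>G\<in>C. F \<subseteq> G \<or> G \<subseteq> F) \<and>
        (\<forall>F. 0 \<le> (c F :: real))}"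

text \<open>
  A linear map from \<open>real ^ 'n\<close> to the quotient of \<open>coord_space E\<close> by \<open>char_vec E\<close> is given by
  a linear lift \<open>L\<close>; only the induced map \<open>\<phi>\<close> has to respect the lattices.
\<close>

definition bergman_support :: "(real ^ 'n) set \<Rightarrow> bool" where
  "bergman_support S \<longleftrightarrow>
     (\<exists>E \<I> L. simple_matroid E \<I> \<and> linear L \<and> range L \<subseteq> coord_space E \<and>
        (let W = span {char_vec E};
             \<phi> = (\<lambda>x. quot_pt W (L x));
             N = quot_pt W ` coord_lattice E;
             B = quot_pt W ` bergman_fan_support E \<I>
         in \<phi> ` lattice_pts \<subseteq> N \<and>
            bij_betw \<phi> S B \<and>
            \<phi> ` (S \<inter> lattice_pts) = B \<inter> N))"

definition smooth_support :: "(real ^ 'n) set \<Rightarrow> bool" where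
  "smooth_support Z \<longleftrightarrow>
     (\<forall>x\<in>Z. \<exists>S U. bergman_support S \<and> open U \<and> 0 \<in> U \<and>
        {y. x + y \<in> Z} \<inter> U = S \<inter> U)"


section \<open>Tropical toric varieties and compactifications\<close>

text \<open>A point of the stratum of \<open>\<sigma>\<close> is a pair of \<open>\<sigma>\<close> and a coset of \<open>span \<sigma>\<close>.\<close>

type_synonym 'n trop_pt = "(real ^ 'n) set \<times> (real ^ 'n) set"

definition tp_chart :: "(real ^ 'n) set \<Rightarrow> 'n trop_pt set" where
  "tp_chart \<sigma> = {(\<tau>, quot_pt (span \<tau>) x) | \<tau> x. \<tau> face_of \<sigma> \<and> \<tau> \<noteq> {}}"

definition dual_monoid :: "(real ^ 'n) set \<Rightarrow> (real ^ 'n) set" where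
  "dual_monoid \<sigma> = {m \<in> lattice_pts. \<forall>x\<in>\<sigma>. 0 \<le> m \<bullet> x}"

text \<open>The monoid homomorphism attached to a point of a chart: \<open>m\<close> is evaluated on the coset if
  it vanishes on the cone of the stratum, and has value \<open>\<infinity>\<close> otherwise.\<close>

definition tp_eval :: "'n trop_pt \<Rightarrow> real ^ 'n \<Rightarrow> ereal" where
  "tp_eval p m =
     (if \<forall>x\<in>fst p. m \<bullet> x = 0 then ereal (m \<bullet> (SOME x. x \<in> snd p)) else \<infinity>)"

definition tp_chart_topology :: "(real ^ 'n) set \<Rightarrow> 'n trop_pt topology" where
  "tp_chart_topology \<sigma> =
     pullback_topology (tp_chart \<sigma>)
       (\<lambda>p. restrict (tp_eval p) (dual_monoid \<sigma>))
       (product_topology (\<lambda>_. euclidean) (dual_monoid \<sigma>))"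

definition tp_topology :: "(real ^ 'n) set set \<Rightarrow> 'n trop_pt topology" where
  "tp_topology \<Delta> =
     topology_generated_by {V. \<exists>\<sigma>\<in>\<Delta>. openin (tp_chart_topology \<sigma>) V}"

definition tp_embed :: "real ^ 'n \<Rightarrow> 'n trop_pt" where
  "tp_embed x = ({0}, quot_pt {0} x)"

text \<open>The support of the extended polyhedral complex induced by \<open>Y\<close>.\<close>

definition compactification :: "(real ^ 'n) set set \<Rightarrow> 'n trop_pt set" where
  "compactification Y = tp_topology (recession_fan Y) closure_of (tp_embed ` \<Union>Y)"

definition finite_part :: "(real ^ 'n) set set \<Rightarrow> (real ^ 'n) set set" where
  "finite_part Y = {P \<in> Y. compact P}"


section \<open>Fans in quotients and their Chow rings\<close>

definition tangent :: "(real ^ 'n) set \<Rightarrow> (real ^ 'n) set" where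
  "tangent P = span {x - y | x y. x \<in> P \<and> y \<in> P}"

text \<open>For a face \<open>P\<close> of \<open>Q\<close> this cone contains \<open>tangent P\<close>, hence is the full preimage of
  its image modulo \<open>tangent P\<close>.\<close>

definition star_cone :: "(real ^ 'n) set \<Rightarrow> (real ^ 'n) set \<Rightarrow> (real ^ 'n) set" where
  "star_cone P Q = convex_cone hull {x - y | x y. x \<in> Q \<and> y \<in> P}"

definition star_fan :: "(real ^ 'n) set set \<Rightarrow> (real ^ 'n) set \<Rightarrow> (real ^ 'n) set set" where
  "star_fan Y P = {star_cone P Q | Q. Q \<in> Y \<and> P \<subseteq> Q}"

definition fan_rays :: "(real ^ 'n) set \<Rightarrow> (real ^ 'n) set set \<Rightarrow> (real ^ 'n) set set" where
  "fan_rays W \<Sigma> =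
     {\<rho> \<in> \<Sigma>. \<exists>v. v \<notin> W \<and> \<rho> = {t *\<^sub>R v + w | t w. 0 \<le> t \<and> w \<in> W}}"

text \<open>A representative of the primitive generator of a ray in \<open>V/W\<close>: the lattice points of the
  ray are its non-negative integral multiples, modulo \<open>W\<close>.\<close>

definition ray_gen :: "(real ^ 'n) set \<Rightarrow> (real ^ 'n) set \<Rightarrow> real ^ 'n" where
  "ray_gen W \<rho> = (SOME v. v \<in> lattice_pts \<and>
     \<rho> \<inter> {z + w | z w. z \<in> lattice_pts \<and> w \<in> W} = {of_nat k *\<^sub>R v + w | k w. w \<in> W})"

definition linear_form :: "(real ^ 'n) set \<Rightarrow> (real ^ 'n \<Rightarrow> real) \<Rightarrow> bool" where
  "linear_form W f \<longleftrightarrow> linear f \<and> (\<forall>w\<in>W. f w = 0)"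

text \<open>Real polynomials in variables indexed by \<open>'v\<close>: exponents are elements of \<open>'v \<Rightarrow>\<^sub>0 nat\<close>.\<close>

type_synonym 'v rpoly = "('v \<Rightarrow>\<^sub>0 nat) \<Rightarrow>\<^sub>0 real"

definition pvar :: "'v \<Rightarrow> 'v rpoly" where
  "pvar v = Poly_Mapping.single (Poly_Mapping.single v 1) 1"

definition pconst :: "real \<Rightarrow> 'v rpoly" where
  "pconst a = Poly_Mapping.single 0 a"

definition poly_ring :: "'v set \<Rightarrow> 'v rpoly ring" where
  "poly_ring R =
     \<lparr>carrier = {p. \<forall>m\<in>Poly_Mapping.keys p. Poly_Mapping.keys m \<subseteq> R},
      monoid.mult = (*), one = 1, zero = 0, add = (+)\<rparr>"

definition homogeneous :: "nat \<Rightarrow> 'v rpoly \<Rightarrow> bool" where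
  "homogeneous k p \<longleftrightarrow>
     (\<forall>m\<in>Poly_Mapping.keys p. (\<Sum>v\<in>Poly_Mapping.keys m. Poly_Mapping.lookup m v) = k)"

definition poly_subst :: "('v \<Rightarrow> 'w rpoly) \<Rightarrow> 'v rpoly \<Rightarrow> 'w rpoly" where
  "poly_subst \<phi> p =
     (\<Sum>m\<in>Poly_Mapping.keys p. pconst (Poly_Mapping.lookup p m) *
        (\<Prod>v\<in>Poly_Mapping.keys m. \<phi> v ^ Poly_Mapping.lookup m v))"

text \<open>The element given by the sum over the rays of \<open>f\<close> at the generator times the variable.\<close>

definition ray_sum ::
    "(real ^ 'n) set \<Rightarrow> (real ^ 'n) set set \<Rightarrow> (real ^ 'n \<Rightarrow> real) \<Rightarrow> (real ^ 'n) set rpoly" where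
  "ray_sum W \<Sigma> f = (\<Sum>\<rho>\<in>fan_rays W \<Sigma>. pconst (f (ray_gen W \<rho>)) * pvar \<rho>)"

definition chow_poly_ring ::
    "(real ^ 'n) set \<Rightarrow> (real ^ 'n) set set \<Rightarrow> (real ^ 'n) set rpoly ring" where
  "chow_poly_ring W \<Sigma> = poly_ring (fan_rays W \<Sigma>)"

definition chow_ideal1 ::
    "(real ^ 'n) set \<Rightarrow> (real ^ 'n) set set \<Rightarrow> (real ^ 'n) set rpoly set" where
  "chow_ideal1 W \<Sigma> = Idl\<^bsub>chow_poly_ring W \<Sigma>\<^esub>
     {\<Prod>\<rho>\<in>S. pvar \<rho> | S. S \<subseteq> fan_rays W \<Sigma> \<and> convex_cone hull (W \<union> \<Union>S) \<notin> \<Sigma>}"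

definition chow_ideal2 ::
    "(real ^ 'n) set \<Rightarrow> (real ^ 'n) set set \<Rightarrow> (real ^ 'n) set rpoly set" where
  "chow_ideal2 W \<Sigma> = Idl\<^bsub>chow_poly_ring W \<Sigma>\<^esub> {ray_sum W \<Sigma> f | f. linear_form W f}"

definition chow_ideal ::
    "(real ^ 'n) set \<Rightarrow> (real ^ 'n) set set \<Rightarrow> (real ^ 'n) set rpoly set" where
  "chow_ideal W \<Sigma> = chow_ideal1 W \<Sigma> <+>\<^bsub>chow_poly_ring W \<Sigma>\<^esub> chow_ideal2 W \<Sigma>"

definition chow_ring ::
    "(real ^ 'n) set \<Rightarrow> (real ^ 'n) set set \<Rightarrow> (real ^ 'n) set rpoly set ring" where
  "chow_ring W \<Sigma> = chow_poly_ring W \<Sigma> Quot chow_ideal W \<Sigma>"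

definition chow_class ::
    "(real ^ 'n) set \<Rightarrow> (real ^ 'n) set set \<Rightarrow> (real ^ 'n) set rpoly \<Rightarrow> (real ^ 'n) set rpoly set" where
  "chow_class W \<Sigma> p = chow_ideal W \<Sigma> +>\<^bsub>chow_poly_ring W \<Sigma>\<^esub> p"

definition chow_group ::
    "nat \<Rightarrow> (real ^ 'n) set \<Rightarrow> (real ^ 'n) set set \<Rightarrow> (real ^ 'n) set rpoly set set" where
  "chow_group k W \<Sigma> =
     {c \<in> carrier (chow_ring W \<Sigma>).
        \<exists>p \<in> carrier (chow_poly_ring W \<Sigma>). homogeneous k p \<and> c = chow_class W \<Sigma> p}"

definition conewise_linear ::
    "(real ^ 'n) set \<Rightarrow> (real ^ 'n) set set \<Rightarrow> (real ^ 'n \<Rightarrow> real) \<Rightarrow> bool" where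
  "conewise_linear W \<Sigma> f \<longleftrightarrow> (\<forall>\<sigma>\<in>\<Sigma>. \<exists>l. linear_form W l \<and> (\<forall>x\<in>\<sigma>. f x = l x))"

definition ample ::
    "(real ^ 'n) set \<Rightarrow> (real ^ 'n) set set \<Rightarrow> (real ^ 'n) set rpoly set \<Rightarrow> bool" where
  "ample W \<Sigma> c \<longleftrightarrow>
     c \<in> chow_group 1 W \<Sigma> \<and>
     (\<exists>f. conewise_linear W \<Sigma> f \<and> strictly_convex \<Sigma> f \<and> c = chow_class W \<Sigma> (ray_sum W \<Sigma> f))"


section \<open>Local cohomology and Kaehler classes\<close>

definition H2 :: "(real ^ 'n) set set \<Rightarrow> (real ^ 'n) set \<Rightarrow> (real ^ 'n) set rpoly set set" where
  "H2 Y P = chow_group 1 (tangent P) (star_fan Y P)"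

definition cone_sum :: "(real ^ 'n) set \<Rightarrow> (real ^ 'n) set \<Rightarrow> (real ^ 'n) set" where
  "cone_sum A B = {a + b | a b. a \<in> A \<and> b \<in> B}"

text \<open>The rays \<open>\<rho>'\<close> of the star fan of \<open>v\<close> that span a two-dimensional cone with the ray of
  \<open>e\<close>; such a ray corresponds to the ray of the star fan of \<open>e\<close> with preimage
  \<open>\<rho>' + tangent e\<close>.\<close>

definition link_rays ::
    "(real ^ 'n) set set \<Rightarrow> (real ^ 'n) set \<Rightarrow> (real ^ 'n) set \<Rightarrow> (real ^ 'n) set set" where
  "link_rays Y v e =
     {\<rho>' \<in> fan_rays (tangent v) (star_fan Y v).
        \<rho>' \<noteq> star_cone v e \<and> cone_sum \<rho>' (star_cone v e) \<in> star_fan Y v}"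

definition restrict_var ::
    "(real ^ 'n) set set \<Rightarrow> (real ^ 'n) set \<Rightarrow> (real ^ 'n) set \<Rightarrow> (real ^ 'n \<Rightarrow> real) \<Rightarrow>
     (real ^ 'n) set \<Rightarrow> (real ^ 'n) set rpoly" where
  "restrict_var Y v e f \<rho>' =
     (if \<rho>' = star_cone v e then
        - (\<Sum>\<rho>''\<in>link_rays Y v e.
             pconst (f (ray_gen (tangent v) \<rho>'')) * pvar (cone_sum \<rho>'' (tangent e)))
      else if \<rho>' \<in> link_rays Y v e then pvar (cone_sum \<rho>' (tangent e))
      else 0)"

text \<open>The homomorphism from the Chow ring of the star fan of \<open>v\<close> to that of \<open>e\<close>.  The union
  runs over all representatives \<open>p\<close> and all admissible \<open>f\<close>, on which the class does not depend.\<close>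

definition chow_restrict ::
    "(real ^ 'n) set set \<Rightarrow> (real ^ 'n) set \<Rightarrow> (real ^ 'n) set \<Rightarrow>
     (real ^ 'n) set rpoly set \<Rightarrow> (real ^ 'n) set rpoly set" where
  "chow_restrict Y v e c =
     (\<Union>p\<in>c. \<Union>f\<in>{f. linear_form (tangent v) f \<and> f (ray_gen (tangent v) (star_cone v e)) = 1}.
        chow_class (tangent e) (star_fan Y e) (poly_subst (restrict_var Y v e f) p))"

definition vertices :: "(real ^ 'n) set set \<Rightarrow> (real ^ 'n) set set" where
  "vertices Y = {v \<in> finite_part Y. aff_dim v = 0}"

definition edges :: "(real ^ 'n) set set \<Rightarrow> (real ^ 'n) set set" where
  "edges Y = {e \<in> finite_part Y. aff_dim e = 1}"

definition kaehler_class ::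
    "(real ^ 'n) set set \<Rightarrow> ((real ^ 'n) set \<Rightarrow> (real ^ 'n) set rpoly set) \<Rightarrow> bool" where
  "kaehler_class Y l \<longleftrightarrow>
     (\<forall>v\<in>vertices Y. l v \<in> H2 Y v \<and> ample (tangent v) (star_fan Y v) (l v)) \<and>
     (\<forall>e\<in>edges Y. \<forall>u\<in>vertices Y. \<forall>v\<in>vertices Y. u \<subseteq> e \<and> v \<subseteq> e \<and> u \<noteq> v \<longrightarrow>
        chow_restrict Y u e (l u) = chow_restrict Y v e (l v))"

text \<open>A unimodular triangulation of a subset \<open>Z\<close> of the tropical toric variety of \<open>\<Delta>\<close> is
  represented by the unimodular complex in \<open>real ^ 'n\<close> inducing it.\<close>

definition unimodular_triangulation ::
    "(real ^ 'n) set set \<Rightarrow> 'n trop_pt set \<Rightarrow> (real ^ 'n) set set \<Rightarrow> bool" where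
  "unimodular_triangulation \<Delta> Z Y \<longleftrightarrow>
     unimodular_complex Y \<and> recession_fan Y = \<Delta> \<and> compactification Y = Z"

definition kaehler :: "(real ^ 'n) set set \<Rightarrow> 'n trop_pt set \<Rightarrow> bool" where
  "kaehler \<Delta> Z \<longleftrightarrow> (\<exists>Y l. unimodular_triangulation \<Delta> Z Y \<and> kaehler_class Y l)"

end

theory Submission
  imports Defs
begin

text \<open>
  Let \<open>f\<close> be a strictly convex function on the complex \<open>Y\<close>.  At a vertex \<open>v\<close> the directional
  derivatives of \<open>f\<close> form a function on the star fan of \<open>v\<close>; on the star cone of a face \<open>Q\<close> it is the
  linear part \<open>a\<^sub>Q\<close> of \<open>f\<close> on \<open>Q\<close>.  This function is conewise linear and inherits strict convexity
  from \<open>f\<close> (\<open>strictly_convex_dir_deriv\<close>), so its class is ample.  These classes form a Kaehler class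
  on \<open>Y\<close> itself (\<open>kaehler_class_of_strictly_convex\<close>), and \<open>Y\<close> is the required triangulation.

  What remains is that the classes agree on every edge \<open>e\<close>.  Subtracting the linear form \<open>a\<^sub>e\<close> from
  the directional derivative at an end of \<open>e\<close> changes its ray sum by a linear relation only, and the
  new function vanishes along \<open>e\<close>.  Its restriction is therefore the sum, over the rays \<open>\<rho>\<close> of the
  star fan of \<open>e\<close>, of \<open>(a\<^sub>Q - a\<^sub>e)(e\<^sub>\<rho>) x\<^sub>\<rho>\<close>, where \<open>Q\<close> is the face around \<open>e\<close> whose star cone
  is \<open>\<rho>\<close>.  This expression does not refer to the chosen end (\<open>chow_restrict_star_class\<close>).

  The restriction of a class is defined as a union over all representatives and all normalising
  linear forms, so computing it on one representative requires that the substitution of variables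
  maps the Chow ideal at a vertex into the Chow ideal at an edge (\<open>subst_chow_ideal\<close>).  That is a
  statement on a unimodular fan with a distinguished ray \<open>R\<close> and rests on two facts: a cone
  containing \<open>R\<close> is determined by its image modulo the line spanned by \<open>R\<close>
  (\<open>subset_of_star_subset\<close>), and the rays of the link of \<open>R\<close> correspond to the rays of the star of
  \<open>R\<close>, with primitive generators going to primitive generators (\<open>bij_betw_link_rays\<close>,
  \<open>ray_gen_star\<close>).  The star fan of \<open>Y\<close> at a vertex is such a fan because the edge vectors of a
  unimodular polyhedron are part of a lattice basis at each of its vertices
  (\<open>unimodular_star_cone\<close>).
\<close>

section \<open>Substitution homomorphisms of polynomials\<close>

definition monom_subst :: "('v \<Rightarrow> 'w rpoly) \<Rightarrow> ('v \<Rightarrow>\<^sub>0 nat) \<Rightarrow> 'w rpoly" where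
  "monom_subst \<phi> m = (\<Prod>v\<in>Poly_Mapping.keys m. \<phi> v ^ Poly_Mapping.lookup m v)"

lemma monom_subst_superset:
  assumes "finite V" "Poly_Mapping.keys m \<subseteq> V"
  shows "monom_subst \<phi> m = (\<Prod>v\<in>V. \<phi> v ^ Poly_Mapping.lookup m v)"
  unfolding monom_subst_def using assms
  by (intro prod.mono_neutral_left) (auto simp: in_keys_iff)

lemma monom_subst_add: "monom_subst \<phi> (m + n) = monom_subst \<phi> m * monom_subst \<phi> n"
proof -
  let ?V = "Poly_Mapping.keys m \<union> Poly_Mapping.keys n"
  have "monom_subst \<phi> (m + n) = (\<Prod>v\<in>?V. \<phi> v ^ Poly_Mapping.lookup (m + n) v)"
    by (intro monom_subst_superset) (use Poly_Mapping.keys_add[of m n] in auto)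
  also have "\<dots> = (\<Prod>v\<in>?V. \<phi> v ^ Poly_Mapping.lookup m v) * (\<Prod>v\<in>?V. \<phi> v ^ Poly_Mapping.lookup n v)"
    by (simp add: lookup_add power_add prod.distrib)
  also have "\<dots> = monom_subst \<phi> m * monom_subst \<phi> n"
    using monom_subst_superset[of ?V m \<phi>] monom_subst_superset[of ?V n \<phi>] by simp
  finally show ?thesis .
qed

lemma poly_subst_superset:
  assumes "finite M" "Poly_Mapping.keys p \<subseteq> M"
  shows "poly_subst \<phi> p = (\<Sum>m\<in>M. pconst (Poly_Mapping.lookup p m) * monom_subst \<phi> m)"
  unfolding poly_subst_def monom_subst_def using assms
  by (intro sum.mono_neutral_left) (auto simp: in_keys_iff pconst_def)

lemma pconst_add: "pconst (a + b) = pconst a + pconst b"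
  by (simp add: pconst_def single_add)

lemma pconst_mult: "pconst (a * b) = pconst a * pconst b"
  by (simp add: pconst_def mult_single)

lemma pconst_diff: "pconst (a - b) = pconst a - pconst b"
  by (simp add: pconst_def single_diff)

lemma pconst_0 [simp]: "pconst 0 = 0"
  by (simp add: pconst_def)

lemma pconst_1 [simp]: "pconst 1 = 1"
  by (simp add: pconst_def)

lemma poly_subst_add: "poly_subst \<phi> (p + q) = poly_subst \<phi> p + poly_subst \<phi> q"
proof -
  let ?M = "Poly_Mapping.keys p \<union> Poly_Mapping.keys q"
  have "poly_subst \<phi> (p + q) = (\<Sum>m\<in>?M. pconst (Poly_Mapping.lookup (p + q) m) * monom_subst \<phi> m)"
    by (intro poly_subst_superset) (use Poly_Mapping.keys_add[of p q] in auto)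
  also have "\<dots> = (\<Sum>m\<in>?M. pconst (Poly_Mapping.lookup p m) * monom_subst \<phi> m) +
      (\<Sum>m\<in>?M. pconst (Poly_Mapping.lookup q m) * monom_subst \<phi> m)"
    by (simp add: lookup_add pconst_add distrib_right sum.distrib)
  also have "\<dots> = poly_subst \<phi> p + poly_subst \<phi> q"
    using poly_subst_superset[of ?M p \<phi>] poly_subst_superset[of ?M q \<phi>] by simp
  finally show ?thesis .
qed

lemma poly_subst_0 [simp]: "poly_subst \<phi> 0 = 0"
  by (simp add: poly_subst_def)

lemma poly_subst_sum: "poly_subst \<phi> (sum p A) = (\<Sum>a\<in>A. poly_subst \<phi> (p a))"
  by (induction A rule: infinite_finite_induct) (auto simp: poly_subst_add)

lemma poly_subst_single: "poly_subst \<phi> (Poly_Mapping.single m a) = pconst a * monom_subst \<phi> m"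
  using poly_subst_superset[of "{m}" "Poly_Mapping.single m a" \<phi>] by (simp add: lookup_single)

text \<open>
  Reduces multiplicativity of substitutions to monomials.
\<close>

lemma rpoly_as_sum:
  fixes p :: "'v rpoly"
  shows "p = (\<Sum>m\<in>Poly_Mapping.keys p. Poly_Mapping.single m (Poly_Mapping.lookup p m))"
proof (rule poly_mapping_eqI)
  fix k
  show "Poly_Mapping.lookup p k =
      Poly_Mapping.lookup (\<Sum>m\<in>Poly_Mapping.keys p. Poly_Mapping.single m (Poly_Mapping.lookup p m)) k"
    by (simp add: lookup_sum lookup_single when_def in_keys_iff)
qed

text \<open>
  Both sides are biadditive, so it suffices to compare them on monomials, where multiplication
  adds exponents.
\<close>

lemma poly_subst_mult: "poly_subst \<phi> (p * q) = poly_subst \<phi> p * poly_subst \<phi> q"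
proof -
  let ?s = "\<lambda>p m. Poly_Mapping.single m (Poly_Mapping.lookup p m)"
  have single: "poly_subst \<phi> (Poly_Mapping.single m a * Poly_Mapping.single n b) =
      poly_subst \<phi> (Poly_Mapping.single m a) * poly_subst \<phi> (Poly_Mapping.single n b)" for m n a b
    by (simp add: mult_single poly_subst_single monom_subst_add pconst_mult ac_simps)
  have "poly_subst \<phi> ((\<Sum>m\<in>Poly_Mapping.keys p. ?s p m) * (\<Sum>n\<in>Poly_Mapping.keys q. ?s q n)) =
      (\<Sum>m\<in>Poly_Mapping.keys p. \<Sum>n\<in>Poly_Mapping.keys q. poly_subst \<phi> (?s p m) * poly_subst \<phi> (?s q n))"
    by (simp only: sum_product poly_subst_sum single)
  also have "\<dots> = poly_subst \<phi> (\<Sum>m\<in>Poly_Mapping.keys p. ?s p m) * poly_subst \<phi> (\<Sum>n\<in>Poly_Mapping.keys q. ?s q n)"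
    by (simp only: sum_product poly_subst_sum)
  finally show ?thesis
    by (simp only: rpoly_as_sum[symmetric])
qed

lemma poly_subst_1 [simp]: "poly_subst \<phi> 1 = 1"
  using poly_subst_single[of \<phi> 0 1] by (simp add: monom_subst_def)

lemma poly_subst_prod: "poly_subst \<phi> (prod p A) = (\<Prod>a\<in>A. poly_subst \<phi> (p a))"
  by (induction A rule: infinite_finite_induct) (auto simp: poly_subst_mult)

lemma poly_subst_pconst [simp]: "poly_subst \<phi> (pconst a) = pconst a"
  by (simp add: pconst_def poly_subst_single monom_subst_def mult_single)

lemma poly_subst_pvar [simp]: "poly_subst \<phi> (pvar v) = \<phi> v"
  by (simp add: pvar_def poly_subst_single monom_subst_def)

section \<open>Polynomial rings and Chow ideals\<close>

lemma carrier_poly_ring: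
  "carrier (poly_ring R) = {p. \<forall>m\<in>Poly_Mapping.keys p. Poly_Mapping.keys m \<subseteq> R}"
  by (simp add: poly_ring_def)

lemma poly_ring_ops [simp]:
  "mult (poly_ring R) = (*)" "one (poly_ring R) = 1"
  "zero (poly_ring R) = 0" "add (poly_ring R) = (+)"
  by (simp_all add: poly_ring_def)

lemma poly_ring_carrier_simps [simp]:
  "0 \<in> carrier (poly_ring R)" "1 \<in> carrier (poly_ring R)" "pconst a \<in> carrier (poly_ring R)"
  by (auto simp: carrier_poly_ring pconst_def)

lemma pvar_in_poly_ring [simp]: "pvar v \<in> carrier (poly_ring R) \<longleftrightarrow> v \<in> R"
  by (auto simp: carrier_poly_ring pvar_def)

lemma poly_ring_uminus_closed:
  "p \<in> carrier (poly_ring R) \<Longrightarrow> - p \<in> carrier (poly_ring R)"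
  by (auto simp: carrier_poly_ring in_keys_iff)

lemma poly_ring_closed:
  assumes "p \<in> carrier (poly_ring R)" "q \<in> carrier (poly_ring R)"
  shows "p + q \<in> carrier (poly_ring R)" "p * q \<in> carrier (poly_ring R)"
    "p - q \<in> carrier (poly_ring R)"
proof -
  show 1: "p + q \<in> carrier (poly_ring R)"
    using assms Poly_Mapping.keys_add[of p q] by (force simp: carrier_poly_ring)
  show "p * q \<in> carrier (poly_ring R)"
    unfolding carrier_poly_ring
  proof (intro CollectI ballI)
    fix m assume "m \<in> Poly_Mapping.keys (p * q)"
    then obtain a b where "a \<in> Poly_Mapping.keys p" "b \<in> Poly_Mapping.keys q" "m = a + b"
      using keys_mult[of p q] by blast
    then show "Poly_Mapping.keys m \<subseteq> R"
      using assms Poly_Mapping.keys_add[of a b] by (force simp: carrier_poly_ring)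
  qed
  have "p + (- q) \<in> carrier (poly_ring R)"
    using assms poly_ring_uminus_closed[of q] Poly_Mapping.keys_add[of p "- q"] by (force simp: carrier_poly_ring)
  then show "p - q \<in> carrier (poly_ring R)" by simp
qed

lemma poly_ring_sum_closed:
  assumes "\<And>a. a \<in> A \<Longrightarrow> p a \<in> carrier (poly_ring R)"
  shows "sum p A \<in> carrier (poly_ring R)"
  using assms by (induction A rule: infinite_finite_induct) (auto intro: poly_ring_closed)

lemma poly_ring_prod_closed:
  assumes "\<And>a. a \<in> A \<Longrightarrow> p a \<in> carrier (poly_ring R)"
  shows "prod p A \<in> carrier (poly_ring R)"
  using assms by (induction A rule: infinite_finite_induct) (auto intro: poly_ring_closed)

lemma poly_ring_power_closed:
  assumes "p \<in> carrier (poly_ring R)"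
  shows "p ^ k \<in> carrier (poly_ring R)"
  using assms by (induction k) (auto intro: poly_ring_closed)

lemma cring_poly_ring: "cring (poly_ring R)"
proof (rule cringI)
  show "abelian_group (poly_ring R)"
  proof (rule abelian_groupI)
    fix p assume "p \<in> carrier (poly_ring R)"
    then show "\<exists>q\<in>carrier (poly_ring R). q \<oplus>\<^bsub>poly_ring R\<^esub> p = \<zero>\<^bsub>poly_ring R\<^esub>"
      by (intro bexI[of _ "- p"]) (auto intro: poly_ring_uminus_closed)
  qed (auto intro: poly_ring_closed simp: ac_simps)
  show "comm_monoid (poly_ring R)"
    by (rule comm_monoidI) (auto intro: poly_ring_closed simp: ac_simps)
qed (auto simp: algebra_simps)

lemma a_minus_poly_ring:
  assumes "p \<in> carrier (poly_ring R)"
  shows "\<ominus>\<^bsub>poly_ring R\<^esub> p = - p"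
proof -
  interpret cring "poly_ring R" by (rule cring_poly_ring)
  have "- p \<in> carrier (poly_ring R)" using assms by (rule poly_ring_uminus_closed)
  then show ?thesis
    using minus_equality[of "- p" p] assms by simp
qed

lemma poly_subst_closed:
  assumes "p \<in> carrier (poly_ring R)" "\<And>v. v \<in> R \<Longrightarrow> \<phi> v \<in> carrier (poly_ring S)"
  shows "poly_subst \<phi> p \<in> carrier (poly_ring S)"
  unfolding poly_subst_def using assms
  by (intro poly_ring_sum_closed poly_ring_closed poly_ring_prod_closed poly_ring_power_closed)
    (simp, use assms in \<open>auto simp: carrier_poly_ring[of R]\<close>)

lemma poly_ring_ideal_closed:
  assumes "ideal I (poly_ring R)"
  shows "0 \<in> I" "I \<subseteq> carrier (poly_ring R)"
    "\<And>p q. p \<in> I \<Longrightarrow> q \<in> I \<Longrightarrow> p + q \<in> I"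
    "\<And>p. p \<in> I \<Longrightarrow> - p \<in> I"
    "\<And>p q. p \<in> I \<Longrightarrow> q \<in> carrier (poly_ring R) \<Longrightarrow> q * p \<in> I"
proof -
  interpret ideal I "poly_ring R" by (rule assms)
  note sub_ax = ideal.axioms(1)[OF assms]
  show "0 \<in> I" using additive_subgroup.zero_closed[OF sub_ax] by simp
  show sub: "I \<subseteq> carrier (poly_ring R)" using additive_subgroup.a_subset[OF sub_ax] .
  show "p + q \<in> I" if "p \<in> I" "q \<in> I" for p q using additive_subgroup.a_closed[OF sub_ax that] by simp
  show "- p \<in> I" if "p \<in> I" for p
    using additive_subgroup.a_inv_closed[OF sub_ax that] sub that a_minus_poly_ring by (metis subsetD)
  show "q * p \<in> I" if "p \<in> I" "q \<in> carrier (poly_ring R)" for p q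
    using I_l_closed[OF that] by simp
qed

text \<open>
  A substitution maps one ideal into another as soon as it does so on generators; this is the form
  in which that principle is used, because \<open>genideal\<close> is the smallest ideal containing its generators.
\<close>

lemma ideal_vimage_poly_subst:
  assumes I: "ideal I (poly_ring S)" and \<phi>: "\<And>v. v \<in> R \<Longrightarrow> \<phi> v \<in> carrier (poly_ring S)"
  shows "ideal {p \<in> carrier (poly_ring R). poly_subst \<phi> p \<in> I} (poly_ring R)"
proof -
  interpret cring "poly_ring R" by (rule cring_poly_ring)
  note I_closed = poly_ring_ideal_closed[OF I]
  have minus: "poly_subst \<phi> (- p) = - poly_subst \<phi> p" for p
    using poly_subst_add[of \<phi> p "- p"] by (simp add: eq_neg_iff_add_eq_0 add.commute)
  have \<phi>': "poly_subst \<phi> p \<in> carrier (poly_ring S)" if "p \<in> carrier (poly_ring R)" for p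
    using poly_subst_closed[OF that \<phi>] .
  show ?thesis
  proof (rule idealI[OF ring_axioms])
    show "subgroup {p \<in> carrier (poly_ring R). poly_subst \<phi> p \<in> I} (add_monoid (poly_ring R))"
    proof
      fix p assume p: "p \<in> {p \<in> carrier (poly_ring R). poly_subst \<phi> p \<in> I}"
      have "inv\<^bsub>add_monoid (poly_ring R)\<^esub> p = - p"
        using p a_minus_poly_ring[of p R] by (simp add: a_inv_def)
      then show "inv\<^bsub>add_monoid (poly_ring R)\<^esub> p \<in> {p \<in> carrier (poly_ring R). poly_subst \<phi> p \<in> I}"
        using p by (simp add: minus I_closed poly_ring_uminus_closed)
    qed (auto simp: poly_subst_add I_closed intro: poly_ring_closed)
  next
    fix p q assume "p \<in> {p \<in> carrier (poly_ring R). poly_subst \<phi> p \<in> I}" "q \<in> carrier (poly_ring R)"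
    then show "q \<otimes>\<^bsub>poly_ring R\<^esub> p \<in> {p \<in> carrier (poly_ring R). poly_subst \<phi> p \<in> I}"
      "p \<otimes>\<^bsub>poly_ring R\<^esub> q \<in> {p \<in> carrier (poly_ring R). poly_subst \<phi> p \<in> I}"
      by (auto simp: poly_subst_mult intro!: poly_ring_closed)
        (use I_closed(5) \<phi>' in \<open>auto simp: mult.commute\<close>)
  qed
qed

lemma ray_sum_closed: "ray_sum W \<Sigma> f \<in> carrier (chow_poly_ring W \<Sigma>)"
  unfolding ray_sum_def chow_poly_ring_def
  by (intro poly_ring_sum_closed poly_ring_closed) auto

lemma chow_gens1_closed:
  "{\<Prod>\<rho>\<in>S. pvar \<rho> | S. S \<subseteq> fan_rays W \<Sigma> \<and> convex_cone hull (W \<union> \<Union>S) \<notin> \<Sigma>}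
     \<subseteq> carrier (chow_poly_ring W \<Sigma>)"
  unfolding chow_poly_ring_def by (auto intro!: poly_ring_prod_closed)

lemma chow_gens2_closed:
  "{ray_sum W \<Sigma> f | f. linear_form W f} \<subseteq> carrier (chow_poly_ring W \<Sigma>)"
  using ray_sum_closed by auto

lemma ideal_chow_ideal: "ideal (chow_ideal W \<Sigma>) (chow_poly_ring W \<Sigma>)"
proof -
  interpret cring "chow_poly_ring W \<Sigma>" unfolding chow_poly_ring_def by (rule cring_poly_ring)
  show ?thesis
    unfolding chow_ideal_def chow_ideal1_def chow_ideal2_def
    by (intro add_ideals genideal_ideal chow_gens1_closed chow_gens2_closed)
qed

text \<open>
  The Chow ideal is a sum of two generated ideals, and an ideal containing both kinds of generators
  is closed under addition.
\<close>

lemma chow_ideal_least: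
  assumes "ideal J (chow_poly_ring W \<Sigma>)"
    and gens1: "\<And>S. S \<subseteq> fan_rays W \<Sigma> \<Longrightarrow> convex_cone hull (W \<union> \<Union>S) \<notin> \<Sigma> \<Longrightarrow> (\<Prod>\<rho>\<in>S. pvar \<rho>) \<in> J"
    and gens2: "\<And>f. linear_form W f \<Longrightarrow> ray_sum W \<Sigma> f \<in> J"
  shows "chow_ideal W \<Sigma> \<subseteq> J"
proof -
  interpret cring "chow_poly_ring W \<Sigma>" unfolding chow_poly_ring_def by (rule cring_poly_ring)
  interpret J: ideal J "chow_poly_ring W \<Sigma>" by (rule assms)
  have "chow_ideal1 W \<Sigma> \<subseteq> J" unfolding chow_ideal1_def
    using gens1 by (intro genideal_minimal assms) auto
  moreover have "chow_ideal2 W \<Sigma> \<subseteq> J" unfolding chow_ideal2_def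
    using gens2 by (intro genideal_minimal assms) auto
  ultimately show ?thesis
    unfolding chow_ideal_def set_add_def' by (auto intro: J.a_closed)
qed

lemma chow_ideal_gens:
  shows chow_ideal_nonface: "S \<subseteq> fan_rays W \<Sigma> \<Longrightarrow> convex_cone hull (W \<union> \<Union>S) \<notin> \<Sigma> \<Longrightarrow>
      (\<Prod>\<rho>\<in>S. pvar \<rho>) \<in> chow_ideal W \<Sigma>"
    and chow_ideal_linear: "linear_form W f \<Longrightarrow> ray_sum W \<Sigma> f \<in> chow_ideal W \<Sigma>"
proof -
  interpret cring "chow_poly_ring W \<Sigma>" unfolding chow_poly_ring_def by (rule cring_poly_ring)
  let ?G1 = "{\<Prod>\<rho>\<in>S. pvar \<rho> | S. S \<subseteq> fan_rays W \<Sigma> \<and> convex_cone hull (W \<union> \<Union>S) \<notin> \<Sigma>}"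
  let ?G2 = "{ray_sum W \<Sigma> f | f. linear_form W f}"
  have "chow_ideal W \<Sigma> = Idl\<^bsub>chow_poly_ring W \<Sigma>\<^esub> (chow_ideal1 W \<Sigma> \<union> chow_ideal2 W \<Sigma>)"
    unfolding chow_ideal_def
    by (intro union_genideal[symmetric])
      (auto simp: chow_ideal1_def chow_ideal2_def intro!: genideal_ideal chow_gens1_closed chow_gens2_closed)
  then have sub: "chow_ideal1 W \<Sigma> \<union> chow_ideal2 W \<Sigma> \<subseteq> chow_ideal W \<Sigma>"
    by (auto simp: genideal_def)
  have "?G1 \<subseteq> chow_ideal1 W \<Sigma>" "?G2 \<subseteq> chow_ideal2 W \<Sigma>"
    unfolding chow_ideal1_def chow_ideal2_def by (auto simp: genideal_def)
  with sub show "S \<subseteq> fan_rays W \<Sigma> \<Longrightarrow> convex_cone hull (W \<union> \<Union>S) \<notin> \<Sigma> \<Longrightarrow>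
      (\<Prod>\<rho>\<in>S. pvar \<rho>) \<in> chow_ideal W \<Sigma>"
    and "linear_form W f \<Longrightarrow> ray_sum W \<Sigma> f \<in> chow_ideal W \<Sigma>"
    by blast+
qed

lemma chow_class_eq: "chow_class W \<Sigma> p = (\<lambda>i. i + p) ` chow_ideal W \<Sigma>"
  unfolding chow_class_def a_r_coset_def'
  by (auto simp: chow_poly_ring_def)

lemma chow_class_eqI:
  assumes "p - q \<in> chow_ideal W \<Sigma>"
  shows "chow_class W \<Sigma> p = chow_class W \<Sigma> q"
proof -
  note I = poly_ring_ideal_closed[OF ideal_chow_ideal[of W \<Sigma>, unfolded chow_poly_ring_def]]
  have shift: "(\<lambda>i. i + p) ` chow_ideal W \<Sigma> \<subseteq> (\<lambda>i. i + q) ` chow_ideal W \<Sigma>"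
    if "p - q \<in> chow_ideal W \<Sigma>" for p q
  proof
    fix x assume "x \<in> (\<lambda>i. i + p) ` chow_ideal W \<Sigma>"
    then obtain i where i: "i \<in> chow_ideal W \<Sigma>" "x = i + p" by auto
    then have "x = (i + (p - q)) + q" "i + (p - q) \<in> chow_ideal W \<Sigma>"
      using I(3) that by auto
    then show "x \<in> (\<lambda>i. i + q) ` chow_ideal W \<Sigma>" by blast
  qed
  have "q - p \<in> chow_ideal W \<Sigma>" using I(4)[OF assms] by simp
  with shift[OF assms] shift[of q p] show ?thesis
    unfolding chow_class_eq by blast
qed

lemma chow_class_in_group1:
  shows "chow_class W \<Sigma> (ray_sum W \<Sigma> f) \<in> chow_group 1 W \<Sigma>"
proof -
  have "homogeneous 1 (ray_sum W \<Sigma> f)"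
    unfolding homogeneous_def
  proof
    fix m assume "m \<in> Poly_Mapping.keys (ray_sum W \<Sigma> f)"
    then obtain \<rho> where "m \<in> Poly_Mapping.keys (pconst (f (ray_gen W \<rho>)) * pvar \<rho>)"
      unfolding ray_sum_def using Poly_Mapping.keys_sum by fastforce
    then have "m = Poly_Mapping.single \<rho> 1"
      by (auto simp: pconst_def pvar_def mult_single split: if_splits)
    then show "(\<Sum>v\<in>Poly_Mapping.keys m. Poly_Mapping.lookup m v) = 1"
      by simp
  qed
  moreover have "chow_class W \<Sigma> (ray_sum W \<Sigma> f) \<in> carrier (chow_ring W \<Sigma>)"
    using ray_sum_closed[of W \<Sigma> f]
    by (auto simp: chow_ring_def FactRing_def A_RCOSETS_def' chow_class_def)
  ultimately show ?thesis
    unfolding chow_group_def using ray_sum_closed by blast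
qed

text \<open>
  The restriction of a class is defined as a union over its representatives and over the linear
  forms normalised on the ray of \<open>e\<close>.  If each substitution respects the Chow ideals, all members of
  this union over one form agree; the image \<open>q\<close> of one convenient representative \<open>p\<close> that does not see
  the form then computes the whole union.  The form \<open>f0\<close> keeps the union from being empty.
\<close>

lemma chow_restrict_class:
  assumes ne: "linear_form (tangent v) f0" "f0 (ray_gen (tangent v) (star_cone v e)) = 1"
    and p: "\<And>f. linear_form (tangent v) f \<Longrightarrow> f (ray_gen (tangent v) (star_cone v e)) = 1 \<Longrightarrow>
        poly_subst (restrict_var Y v e f) p = q"
    and I: "\<And>f i. linear_form (tangent v) f \<Longrightarrow> f (ray_gen (tangent v) (star_cone v e)) = 1 \<Longrightarrow>
        i \<in> chow_ideal (tangent v) (star_fan Y v) \<Longrightarrow>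
        poly_subst (restrict_var Y v e f) i \<in> chow_ideal (tangent e) (star_fan Y e)"
  shows "chow_restrict Y v e (chow_class (tangent v) (star_fan Y v) p) =
         chow_class (tangent e) (star_fan Y e) q"
proof -
  let ?I = "chow_ideal (tangent v) (star_fan Y v)"
  let ?F = "{f. linear_form (tangent v) f \<and> f (ray_gen (tangent v) (star_cone v e)) = 1}"
  have "0 \<in> ?I"
    using poly_ring_ideal_closed(1)[OF ideal_chow_ideal[unfolded chow_poly_ring_def]] .
  moreover have "chow_class (tangent e) (star_fan Y e) (poly_subst (restrict_var Y v e f) (i + p)) =
      chow_class (tangent e) (star_fan Y e) q" if "f \<in> ?F" "i \<in> ?I" for f i
    using that p[of f] I[of f i] by (intro chow_class_eqI) (auto simp: poly_subst_add)
  moreover have "f0 \<in> ?F" using ne by simp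
  ultimately show ?thesis
    unfolding chow_restrict_def chow_class_eq[of "tangent v"] by blast
qed

section \<open>Faces of simplicial cones\<close>

lemma convex_cone_sum_mem:
  assumes "convex_cone S" "\<And>a. a \<in> A \<Longrightarrow> f a \<in> S"
  shows "sum f A \<in> S"
  using assms(2) by (induction A rule: infinite_finite_induct)
    (auto intro: convex_cone_add[OF assms(1)] convex_cone_contains_0[OF assms(1)])

lemma convex_cone_hull_finite:
  fixes B :: "'a::real_vector set"
  assumes "finite B"
  shows "convex_cone hull B = {\<Sum>b\<in>B. c b *\<^sub>R b | c. \<forall>b\<in>B. 0 \<le> c b}" (is "_ = ?R")
proof
  have "convex_cone ?R"
    unfolding convex_cone_iff
  proof (intro conjI ballI allI impI)
    show "0 \<in> ?R" by (intro CollectI exI[of _ "\<lambda>_. 0"]) auto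
  next
    fix x y assume "x \<in> ?R" "y \<in> ?R"
    then obtain c d where "x = (\<Sum>b\<in>B. c b *\<^sub>R b)" "\<forall>b\<in>B. 0 \<le> c b"
      "y = (\<Sum>b\<in>B. d b *\<^sub>R b)" "\<forall>b\<in>B. 0 \<le> d b" by blast
    then show "x + y \<in> ?R"
      by (intro CollectI exI[of _ "\<lambda>b. c b + d b"]) (auto simp: sum.distrib scaleR_add_left)
  next
    fix x and t :: real assume "x \<in> ?R" "0 \<le> t"
    then obtain c where "x = (\<Sum>b\<in>B. c b *\<^sub>R b)" "\<forall>b\<in>B. 0 \<le> c b" by blast
    then show "t *\<^sub>R x \<in> ?R" using \<open>0 \<le> t\<close>
      by (intro CollectI exI[of _ "\<lambda>b. t * c b"]) (auto simp: scaleR_sum_right)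
  qed
  moreover have "B \<subseteq> ?R"
  proof
    fix b assume "b \<in> B"
    then have "b = (\<Sum>b'\<in>B. (if b' = b then 1 else 0) *\<^sub>R b')"
      using assms by (simp add: if_distrib[of "\<lambda>c. c *\<^sub>R _"] cong: if_cong)
    then show "b \<in> ?R" by (intro CollectI exI[of _ "\<lambda>b'. if b' = b then 1 else 0"]) auto
  qed
  ultimately show "convex_cone hull B \<subseteq> ?R"
    by (intro hull_minimal)
next
  have "(\<Sum>b\<in>B. c b *\<^sub>R b) \<in> convex_cone hull B" if "\<forall>b\<in>B. 0 \<le> c b" for c
    using that
    by (intro convex_cone_sum_mem[OF convex_cone_convex_cone_hull] convex_cone_hull_mul hull_inc) auto
  then show "?R \<subseteq> convex_cone hull B" by blast
qed

lemma convex_cone_hull_singleton: "convex_cone hull {w} = {t *\<^sub>R w | t. 0 \<le> t}"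
  by (subst convex_cone_hull_finite) auto

lemma convex_cone_hull_subset_span: "convex_cone hull B \<subseteq> span B"
  by (meson convex_cone_span hull_minimal span_superset)

lemma independent_coeffs_eq:
  fixes B :: "'a::real_vector set"
  assumes "independent B" "finite B" "(\<Sum>b\<in>B. c b *\<^sub>R b) = (\<Sum>b\<in>B. d b *\<^sub>R b)" "b \<in> B"
  shows "c b = d b"
proof -
  have "(\<Sum>b\<in>B. (c b - d b) *\<^sub>R b) = 0"
    using assms(3) by (simp add: scaleR_diff_left sum_subtractf)
  then show ?thesis
    using independentD[OF assms(1,2) subset_refl, of "\<lambda>b. c b - d b"] assms(4) by simp
qed

text \<open>
  A nonzero point \<open>x\<close> of a face lies inside the segment from \<open>0\<close> to any larger multiple of \<open>x\<close>, so
  the face contains the ray through \<open>x\<close>.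
\<close>

lemma face_of_convex_cone_imp_convex_cone:
  fixes K :: "'a::real_vector set"
  assumes K: "convex_cone K" and F: "F face_of K" "F \<noteq> {}"
  shows "convex_cone F"
proof -
  have scale: "t *\<^sub>R x \<in> F" if x: "x \<in> F" and t: "0 \<le> t" for x t
  proof (cases "x = 0 \<or> t = 1")
    case False
    \<comment> \<open>The factor exceeds both \<open>1\<close> and \<open>t\<close>, so \<open>x\<close> and \<open>t *\<^sub>R x\<close> lie before the end point \<open>?s *\<^sub>R x\<close>.\<close>
    let ?s = "2 * t + 2"
    have xK: "x \<in> K" using x F face_of_imp_subset by blast
    have "x = (1 - 1 / ?s) *\<^sub>R (0::'a) + (1 / ?s) *\<^sub>R (?s *\<^sub>R x)" using t by simp
    moreover have "?s *\<^sub>R x \<in> K" "0 \<in> K"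
      using convex_cone_scaleR[OF K _ xK, of ?s] t convex_cone_contains_0[OF K] by auto
    moreover have "0 < 1 / ?s" "1 / ?s < 1" using t by auto
    moreover have "0 \<noteq> ?s *\<^sub>R x" using False t by auto
    ultimately have "0 \<in> F" "?s *\<^sub>R x \<in> F"
      using face_ofD[OF F(1), of x 0 "?s *\<^sub>R x"] x unfolding in_segment by blast+
    moreover have "t *\<^sub>R x = (1 - t / ?s) *\<^sub>R (0::'a) + (t / ?s) *\<^sub>R (?s *\<^sub>R x)" using t by simp
    ultimately show ?thesis
      using convexD_alt[OF face_of_imp_convex[OF F(1)], of 0 "?s *\<^sub>R x" "t / ?s"] t by simp
  qed (use x in auto)
  moreover have "x + y \<in> F" if "x \<in> F" "y \<in> F" for x y
  proof -
    have "(1 - 1/2) *\<^sub>R x + (1/2) *\<^sub>R y \<in> F"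
      using convexD_alt[OF face_of_imp_convex[OF F(1)] that, of "1/2"] by simp
    then have "2 *\<^sub>R ((1 - 1/2) *\<^sub>R x + (1/2) *\<^sub>R y) \<in> F" by (intro scale) auto
    then show ?thesis by (simp add: scaleR_add_right)
  qed
  moreover have "0 \<in> F" using scale[of _ 0] F(2) by auto
  ultimately show ?thesis unfolding convex_cone_iff by blast
qed

text \<open>
  Up to the factor 2, a sum is a midpoint.
\<close>

lemma face_of_convex_cone_summand:
  fixes K :: "'a::real_vector set"
  assumes K: "convex_cone K" and F: "F face_of K"
    and "a \<in> K" "b \<in> K" "a + b \<in> F"
  shows "a \<in> F"
proof (cases "a = b")
  case True
  then have "(1/2) *\<^sub>R (a + b) = a" by (simp flip: scaleR_2)
  then show ?thesis
    using convex_cone_scaleR[OF face_of_convex_cone_imp_convex_cone[OF K F], of "1/2" "a + b"] assms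
    by auto
next
  case False
  have FK: "convex_cone F" using face_of_convex_cone_imp_convex_cone[OF K F] assms by blast
  have "a + b = (1 - 1/2) *\<^sub>R (2 *\<^sub>R a) + (1/2) *\<^sub>R (2 *\<^sub>R b)" by simp
  then have "a + b \<in> open_segment (2 *\<^sub>R a) (2 *\<^sub>R b)"
    unfolding in_segment using False by (intro conjI exI[of _ "1/2"]) auto
  then have "2 *\<^sub>R a \<in> F"
    using face_ofD[OF F, of "a + b" "2 *\<^sub>R a" "2 *\<^sub>R b"] assms
      convex_cone_scaleR[OF K] by simp
  from convex_cone_scaleR[OF FK _ this, of "1/2"] show ?thesis by simp
qed

text \<open>
  A nonnegative combination lying in the face has all its summands in the face, so only generators
  in the face occur with a positive coefficient.
\<close>

lemma face_of_simplicial_cone: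
  fixes B :: "'a::real_vector set"
  assumes "finite B" and F: "F face_of (convex_cone hull B)" "F \<noteq> {}"
  shows "F = convex_cone hull (B \<inter> F)"
proof
  note K = convex_cone_convex_cone_hull[of B]
  have FC: "convex_cone F" by (rule face_of_convex_cone_imp_convex_cone[OF K F])
  then show "convex_cone hull (B \<inter> F) \<subseteq> F" by (intro hull_minimal) auto
  show "F \<subseteq> convex_cone hull (B \<inter> F)"
  proof
    fix x assume x: "x \<in> F"
    then obtain c where c: "x = (\<Sum>b\<in>B. c b *\<^sub>R b)" "\<forall>b\<in>B. 0 \<le> c b"
      using face_of_imp_subset[OF F(1)] convex_cone_hull_finite[OF assms(1)] by blast
    have "c b *\<^sub>R b \<in> convex_cone hull (B \<inter> F)" if b: "b \<in> B" for b
    proof (cases "c b = 0")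
      case False
      have "c b *\<^sub>R b \<in> convex_cone hull B"
        using b c by (intro convex_cone_hull_mul hull_inc) auto
      moreover have "(\<Sum>b\<in>B - {b}. c b *\<^sub>R b) \<in> convex_cone hull B"
        using c by (intro convex_cone_sum_mem[OF K] convex_cone_hull_mul hull_inc) auto
      moreover have "c b *\<^sub>R b + (\<Sum>b\<in>B - {b}. c b *\<^sub>R b) \<in> F"
        using x c(1) sum.remove[OF assms(1) b, of "\<lambda>b. c b *\<^sub>R b"] by simp
      ultimately have "c b *\<^sub>R b \<in> F" by (rule face_of_convex_cone_summand[OF K F(1)])
      from convex_cone_scaleR[OF FC _ this, of "1 / c b"] False c(2) b have "b \<in> F" by simp
      then show ?thesis using b c by (intro convex_cone_hull_mul hull_inc) auto
    qed (simp add: convex_cone_hull_contains_0)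
    then show "x \<in> convex_cone hull (B \<inter> F)"
      unfolding c(1) by (intro convex_cone_sum_mem[OF convex_cone_convex_cone_hull])
  qed
qed

text \<open>
  For a point of the smaller cone, linear independence forces the coefficients outside \<open>T\<close> of every
  decomposition to vanish.
\<close>

lemma simplicial_cone_face:
  fixes B :: "'a::real_vector set"
  assumes "independent B" "finite B" "T \<subseteq> B"
  shows "(convex_cone hull T) face_of (convex_cone hull B)"
  unfolding face_of_def
proof (intro conjI ballI impI)
  note finT = finite_subset[OF assms(3,2)]
  show "convex_cone hull T \<subseteq> convex_cone hull B" using assms(3) by (rule hull_mono)
  show "convex (convex_cone hull T)" by (rule convex_convex_cone_hull)
  have main: "p \<in> convex_cone hull T"
    if pq: "p \<in> convex_cone hull B" "q \<in> convex_cone hull B"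
      and st: "0 < s" "0 < t" and x: "s *\<^sub>R p + t *\<^sub>R q \<in> convex_cone hull T" for p q and s t :: real
  proof -
    obtain c d e where c: "p = (\<Sum>b\<in>B. c b *\<^sub>R b)" "\<forall>b\<in>B. 0 \<le> c b"
      and d: "q = (\<Sum>b\<in>B. d b *\<^sub>R b)" "\<forall>b\<in>B. 0 \<le> d b"
      and e: "s *\<^sub>R p + t *\<^sub>R q = (\<Sum>b\<in>T. e b *\<^sub>R b)"
      using pq x convex_cone_hull_finite[OF assms(2)] convex_cone_hull_finite[OF finT] by blast
    have "(\<Sum>b\<in>T. e b *\<^sub>R b) = (\<Sum>b\<in>B. (if b \<in> T then e b else 0) *\<^sub>R b)"
      using assms(2,3) by (intro sum.mono_neutral_cong_left) auto
    then have "(\<Sum>b\<in>B. (s * c b + t * d b) *\<^sub>R b) = (\<Sum>b\<in>B. (if b \<in> T then e b else 0) *\<^sub>R b)"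
      using e c(1) d(1) by (simp add: scaleR_sum_right scaleR_add_left sum.distrib)
    from independent_coeffs_eq[OF assms(1,2) this]
    have "s * c b + t * d b = 0" if "b \<in> B - T" for b using that by auto
    moreover have "0 \<le> s * c b" "0 \<le> t * d b" if "b \<in> B - T" for b
      using that c(2) d(2) st by auto
    ultimately have "s * c b = 0" if "b \<in> B - T" for b
      using that add_nonneg_eq_0_iff by blast
    then have zero: "c b = 0" if "b \<in> B - T" for b
      using that st by auto
    have "p = (\<Sum>b\<in>T. c b *\<^sub>R b)"
      unfolding c(1) using assms(2,3) zero by (intro sum.mono_neutral_right) auto
    then show ?thesis
      using c(2) assms(3) convex_cone_hull_finite[OF finT] by blast
  qed
  fix a b x assume ab: "a \<in> convex_cone hull B" "b \<in> convex_cone hull B"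
    and x: "x \<in> convex_cone hull T" "x \<in> open_segment a b"
  then obtain u where u: "0 < u" "u < 1" "x = (1 - u) *\<^sub>R a + u *\<^sub>R b"
    unfolding in_segment by blast
  show "a \<in> convex_cone hull T" using main[OF ab, of "1 - u" u] u x by simp
  show "b \<in> convex_cone hull T" using main[of b a u "1 - u"] ab u x by (simp add: add.commute)
qed

section \<open>Parts of lattice bases and primitive generators\<close>

definition lattice_part :: "(real ^ 'n) set \<Rightarrow> bool" where
  "lattice_part B \<longleftrightarrow> (\<exists>B'. B \<subseteq> B' \<and> lattice_basis B')"

lemma lattice_part_subset: "lattice_part B \<Longrightarrow> C \<subseteq> B \<Longrightarrow> lattice_part C"
  unfolding lattice_part_def by blast

lemma lattice_part_finite: "lattice_part B \<Longrightarrow> finite B"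
  unfolding lattice_part_def lattice_basis_def using finite_subset by blast

lemma lattice_part_independent: "lattice_part B \<Longrightarrow> independent B"
  unfolding lattice_part_def lattice_basis_def using independent_mono by blast

lemma lattice_pts_closed:
  "0 \<in> lattice_pts" "x \<in> lattice_pts \<Longrightarrow> y \<in> lattice_pts \<Longrightarrow> x + y \<in> lattice_pts"
  "x \<in> lattice_pts \<Longrightarrow> of_int k *\<^sub>R x \<in> lattice_pts"
  "x \<in> lattice_pts \<Longrightarrow> of_nat j *\<^sub>R x \<in> lattice_pts"
  by (auto simp: lattice_pts_def)

lemma lattice_pts_sum: "(\<And>a. a \<in> A \<Longrightarrow> f a \<in> lattice_pts) \<Longrightarrow> sum f A \<in> lattice_pts"
  by (induction A rule: infinite_finite_induct) (auto simp: lattice_pts_closed)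

lemma lattice_basis_pts_iff:
  assumes "lattice_basis B"
  shows "z \<in> lattice_pts \<longleftrightarrow> (\<exists>c :: _ \<Rightarrow> int. z = (\<Sum>b\<in>B. of_int (c b) *\<^sub>R b))"
proof -
  have eq: "{\<Sum>b\<in>B. of_int (c b) *\<^sub>R b | c :: _ \<Rightarrow> int. True} = lattice_pts"
    using assms by (simp only: lattice_basis_def)
  show ?thesis by (subst eq[symmetric]) simp
qed

lemma lattice_basis_subset_pts:
  assumes "lattice_basis B"
  shows "B \<subseteq> lattice_pts"
proof
  fix b assume b: "b \<in> B"
  have "finite B" using assms by (simp add: lattice_basis_def)
  then have "b = (\<Sum>b'\<in>B. of_int (if b' = b then 1 else 0) *\<^sub>R b')"
    using b by (simp add: if_distrib[of "\<lambda>c. of_int c *\<^sub>R _"] cong: if_cong)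
  then show "b \<in> lattice_pts"
    unfolding lattice_basis_pts_iff[OF assms] by metis
qed

lemma lattice_part_subset_pts: "lattice_part B \<Longrightarrow> B \<subseteq> lattice_pts"
  unfolding lattice_part_def using lattice_basis_subset_pts by blast

text \<open>
  Coordinates with respect to a linearly independent family are unique, hence agree with the
  integral ones provided by a lattice basis.
\<close>

lemma lattice_part_integer_coeffs:
  assumes "lattice_part B" "(\<Sum>b\<in>B. c b *\<^sub>R b) \<in> lattice_pts" "b \<in> B"
  shows "c b \<in> \<int>"
proof -
  obtain B' where B': "B \<subseteq> B'" "lattice_basis B'" using assms(1) lattice_part_def by blast
  then have fin: "finite B'" and ind: "independent B'" by (auto simp: lattice_basis_def)
  obtain d :: "_ \<Rightarrow> int" where d: "(\<Sum>b\<in>B. c b *\<^sub>R b) = (\<Sum>b\<in>B'. of_int (d b) *\<^sub>R b)"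
    using assms(2) lattice_basis_pts_iff[OF B'(2)] by auto
  have "(\<Sum>b\<in>B. c b *\<^sub>R b) = (\<Sum>b\<in>B'. (if b \<in> B then c b else 0) *\<^sub>R b)"
    using fin B'(1) by (intro sum.mono_neutral_cong_left) auto
  then have "(if b \<in> B then c b else 0) = of_int (d b)"
    using d assms(3) B'(1) by (intro independent_coeffs_eq[OF ind fin]) auto
  then show ?thesis using assms(3) by simp
qed

lemma lattice_part_nonzero: "lattice_part B \<Longrightarrow> b \<in> B \<Longrightarrow> b \<noteq> 0"
  using lattice_part_independent dependent_zero by blast

lemma cone_sum_0 [simp]: "cone_sum A {0} = A"
  by (auto simp: cone_sum_def)

text \<open>
  The generator \<open>w\<close> satisfies the characterisation of a primitive generator of the ray modulo
  \<open>span B\<close>, because coordinates of lattice points along a lattice basis are integers.  Any two such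
  generators are integral nonnegative multiples of each other modulo \<open>span B\<close>, hence congruent.
\<close>

lemma ray_gen_mod:
  assumes lp: "lattice_part (insert w B)" and wB: "w \<notin> B"
  shows "ray_gen (span B) (cone_sum (convex_cone hull {w}) (span B)) - w \<in> span B"
proof -
  let ?\<rho> = "cone_sum (convex_cone hull {w}) (span B)"
  let ?L = "{z + u | z u. z \<in> lattice_pts \<and> u \<in> span B}"
  let ?M = "\<lambda>v. {of_nat k *\<^sub>R v + u | k u. u \<in> span B}"
  have fin: "finite B" using lattice_part_finite[OF lp] by simp
  have wl: "w \<in> lattice_pts" using lattice_part_subset_pts[OF lp] by blast
  have w_span: "w \<notin> span B"
    using lattice_part_independent[OF lp] wB by (simp add: independent_insert)
  have "?\<rho> \<inter> ?L = ?M w"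
  proof
    show "?\<rho> \<inter> ?L \<subseteq> ?M w"
    proof
      fix x assume x: "x \<in> ?\<rho> \<inter> ?L"
      then obtain t u where t: "0 \<le> t" "u \<in> span B" "x = t *\<^sub>R w + u"
        by (auto simp: cone_sum_def convex_cone_hull_singleton)
      obtain z u' where z: "z \<in> lattice_pts" "u' \<in> span B" "x = z + u'" using x by blast
      have "u - u' \<in> span B" using t z by (intro span_diff)
      then obtain d where d: "u - u' = (\<Sum>b\<in>B. d b *\<^sub>R b)"
        using span_finite[OF fin] by auto
      have "z = t *\<^sub>R w + (u - u')" using t z by (simp add: algebra_simps)
      also have "\<dots> = (\<Sum>b\<in>insert w B. (d(w := t)) b *\<^sub>R b)"
        using fin wB d by (subst sum.insert) (auto intro!: sum.cong)
      finally have "t \<in> \<int>"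
        using lattice_part_integer_coeffs[OF lp, of "d(w := t)" w] z(1) by simp
      then obtain k :: nat where "t = of_nat k"
        using t(1) by (metis Ints_cases of_int_0_le_iff of_int_of_nat_eq zero_le_imp_eq_int)
      then show "x \<in> ?M w" using t by blast
    qed
    show "?M w \<subseteq> ?\<rho> \<inter> ?L"
      using lattice_pts_closed(4)[OF wl]
      by (fastforce simp: cone_sum_def convex_cone_hull_singleton)
  qed
  then have "w \<in> lattice_pts \<and> ?\<rho> \<inter> ?L = ?M w" using wl by simp
  then have v: "ray_gen (span B) ?\<rho> \<in> lattice_pts \<and> ?\<rho> \<inter> ?L = ?M (ray_gen (span B) ?\<rho>)"
    unfolding ray_gen_def by (rule someI)
  let ?v = "ray_gen (span B) ?\<rho>"
  have eq: "?M ?v = ?M w" using v \<open>?\<rho> \<inter> ?L = ?M w\<close> by simp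
  have self: "x \<in> ?M x" for x
    using span_zero[of B] by (intro CollectI exI[of _ 1] exI[of _ 0]) auto
  obtain k u where k: "?v = of_nat k *\<^sub>R w + u" "u \<in> span B" using self[of ?v] eq by blast
  obtain j u' where j: "w = of_nat j *\<^sub>R ?v + u'" "u' \<in> span B" using self[of w] eq by blast
  have "(1 - of_nat j * of_nat k) *\<^sub>R w = of_nat j *\<^sub>R u + u'"
    using j(1) unfolding k(1) by (simp add: algebra_simps)
  moreover have "of_nat j *\<^sub>R u + u' \<in> span B"
    using j k by (intro span_add span_scale)
  ultimately have "(1 - of_nat j * of_nat k) *\<^sub>R w \<in> span B" by simp
  then have "(1 / (1 - of_nat j * of_nat k)) *\<^sub>R (1 - of_nat j * of_nat k) *\<^sub>R w \<in> span B"
    by (rule span_scale)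
  then have "1 - of_nat j * of_nat k = (0::real)"
    using w_span by (cases "1 - of_nat j * of_nat k = (0::real)") auto
  then have "real (j * k) = real 1" by simp
  then have "j * k = 1" by (simp only: of_nat_eq_iff)
  then have "k = 1" by simp
  then show ?thesis using k by simp
qed

text \<open>
  The case \<open>B = {}\<close>, where the quotient is the whole space and the generator is determined exactly.
\<close>

lemma ray_gen_ray:
  assumes "lattice_part {w}"
  shows "ray_gen {0} (convex_cone hull {w}) = w"
  using ray_gen_mod[of w "{}"] assms by simp

lemma lattice_ray_inject:
  assumes "lattice_part {w}" "lattice_part {w'}" "convex_cone hull {w} = convex_cone hull {w'}"
  shows "w = w'"
  using ray_gen_ray assms by metis

section \<open>Unimodular fans and the star of a ray\<close>

text \<open>
  A fan whose cones are spanned by parts of lattice bases, in the form needed for star fans at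
  vertices.  The cones are pointed because their generators are independent.
\<close>

definition unimodular_fan :: "(real ^ 'n) set set \<Rightarrow> bool" where
  "unimodular_fan \<Sigma> \<longleftrightarrow> finite \<Sigma> \<and>
     (\<forall>\<sigma>\<in>\<Sigma>. \<exists>B. lattice_part B \<and> \<sigma> = convex_cone hull B) \<and>
     (\<forall>\<sigma>\<in>\<Sigma>. \<forall>\<tau>. \<tau> face_of \<sigma> \<and> \<tau> \<noteq> {} \<longrightarrow> \<tau> \<in> \<Sigma>) \<and>
     (\<forall>\<sigma>\<in>\<Sigma>. \<forall>\<tau>\<in>\<Sigma>. (\<sigma> \<inter> \<tau>) face_of \<sigma>)"

lemma unimodular_fan_face:
  "unimodular_fan \<Sigma> \<Longrightarrow> \<sigma> \<in> \<Sigma> \<Longrightarrow> \<tau> face_of \<sigma> \<Longrightarrow> \<tau> \<noteq> {} \<Longrightarrow> \<tau> \<in> \<Sigma>"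
  by (simp add: unimodular_fan_def)

lemma unimodular_fan_Int:
  "unimodular_fan \<Sigma> \<Longrightarrow> \<sigma> \<in> \<Sigma> \<Longrightarrow> \<tau> \<in> \<Sigma> \<Longrightarrow> (\<sigma> \<inter> \<tau>) face_of \<sigma>"
  by (simp add: unimodular_fan_def)

lemma unimodular_fan_cone:
  assumes "unimodular_fan \<Sigma>" "\<sigma> \<in> \<Sigma>"
  obtains B where "lattice_part B" "\<sigma> = convex_cone hull B"
proof -
  have "\<exists>B. lattice_part B \<and> \<sigma> = convex_cone hull B"
    using assms by (simp add: unimodular_fan_def)
  then show ?thesis using that by blast
qed

lemma cone_sum_convex_cone_hull:
  "cone_sum (convex_cone hull A) (convex_cone hull B) = convex_cone hull (A \<union> B)"
  by (auto simp: convex_cone_hull_Un cone_sum_def)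

lemma cone_sum_span_absorb:
  assumes "0 \<in> A" "A \<subseteq> span B"
  shows "cone_sum (cone_sum C A) (span B) = cone_sum C (span B)"
proof
  show "cone_sum (cone_sum C A) (span B) \<subseteq> cone_sum C (span B)"
    using assms(2) by (fastforce simp: cone_sum_def add.assoc intro: span_add)
  show "cone_sum C (span B) \<subseteq> cone_sum (cone_sum C A) (span B)"
    using assms(1) by (force simp: cone_sum_def)
qed

lemma subset_cone_sum: "0 \<in> B \<Longrightarrow> A \<subseteq> cone_sum A B"
  by (force simp: cone_sum_def)

lemma lattice_part_not_in_span:
  assumes "lattice_part {w, r}" "w \<noteq> r"
  shows "w \<notin> span {r}"
  using lattice_part_independent[OF assms(1)] assms(2) by (simp add: independent_insert)

lemma fan_raysI:
  assumes "\<rho> \<in> \<Sigma>" "v \<notin> W" "\<rho> = {t *\<^sub>R v + w | t w. 0 \<le> t \<and> w \<in> W}"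
  shows "\<rho> \<in> fan_rays W \<Sigma>"
  unfolding fan_rays_def by (intro CollectI conjI exI[of _ v]) (fact assms)+

lemma fan_raysE:
  assumes "\<rho> \<in> fan_rays W \<Sigma>"
  obtains v where "\<rho> \<in> \<Sigma>" "v \<notin> W" "\<rho> = {t *\<^sub>R v + w | t w. 0 \<le> t \<and> w \<in> W}"
  using assms by (auto simp only: fan_rays_def mem_Collect_eq)

text \<open>
  Two independent vectors cannot lie on a common line, so a cone of the fan that is a ray has
  exactly one generator.
\<close>

lemma fan_rays_iff:
  assumes "unimodular_fan \<Sigma>"
  shows "\<rho> \<in> fan_rays {0} \<Sigma> \<longleftrightarrow> \<rho> \<in> \<Sigma> \<and> (\<exists>w. lattice_part {w} \<and> \<rho> = convex_cone hull {w})"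
proof
  assume "\<rho> \<in> fan_rays {0} \<Sigma>"
  then obtain v where \<rho>: "\<rho> \<in> \<Sigma>" "v \<noteq> 0" "\<rho> = {t *\<^sub>R v | t. 0 \<le> t}"
    unfolding fan_rays_def by auto
  then obtain B where B: "lattice_part B" "\<rho> = convex_cone hull B"
    using unimodular_fan_cone[OF assms] by blast
  have multiple: "\<exists>t. b = t *\<^sub>R v" if "b \<in> B" for b
    using hull_inc[OF that, of convex_cone] B(2) \<rho>(3) by auto
  have "v = 1 *\<^sub>R v" by simp
  then have "v \<in> \<rho>" unfolding \<rho>(3) using zero_le_one by blast
  then have "B \<noteq> {}" using B(2) \<rho>(2) by auto
  then obtain w where w: "w \<in> B" by blast
  have "b = w" if b: "b \<in> B" for b
  proof (rule ccontr)
    assume "b \<noteq> w"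
    then have "b \<notin> span {w}"
      using lattice_part_not_in_span lattice_part_subset[OF B(1), of "{b, w}"] b w by blast
    obtain s t where "b = s *\<^sub>R v" "w = t *\<^sub>R v" using multiple b w by blast
    moreover have "w \<noteq> 0" using lattice_part_nonzero B(1) w by blast
    ultimately have "b = (s / t) *\<^sub>R w" by auto
    then show False using \<open>b \<notin> span {w}\<close> span_scale span_base by blast
  qed
  then have "B = {w}" using w by blast
  then show "\<rho> \<in> \<Sigma> \<and> (\<exists>w. lattice_part {w} \<and> \<rho> = convex_cone hull {w})"
    using \<rho>(1) B by blast
next
  assume "\<rho> \<in> \<Sigma> \<and> (\<exists>w. lattice_part {w} \<and> \<rho> = convex_cone hull {w})"
  then obtain w where w: "\<rho> \<in> \<Sigma>" "lattice_part {w}" "\<rho> = convex_cone hull {w}" by blast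
  have "w \<notin> {0}" using lattice_part_nonzero[OF w(2)] by simp
  moreover have "\<rho> = {t *\<^sub>R w + u | t u. 0 \<le> t \<and> u \<in> {0}}"
    unfolding w(3) convex_cone_hull_singleton by simp
  ultimately show "\<rho> \<in> fan_rays {0} \<Sigma>" by (rule fan_raysI[OF w(1)])
qed

text \<open>
  The ray through \<open>w\<close> is a face of the cone, hence spanned by one of the generators; primitivity
  identifies that generator with \<open>w\<close>.
\<close>

lemma ray_in_cone_generator:
  assumes fan: "unimodular_fan \<Sigma>"
    and B: "lattice_part B" "convex_cone hull B \<in> \<Sigma>"
    and w: "lattice_part {w}" "convex_cone hull {w} \<in> \<Sigma>" "w \<in> convex_cone hull B"
  shows "w \<in> B"
proof -
  have "convex_cone hull {w} \<subseteq> convex_cone hull B"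
    using w(3) by (simp add: hull_minimal convex_cone_convex_cone_hull)
  then have "convex_cone hull {w} face_of convex_cone hull B"
    using unimodular_fan_Int[OF fan B(2) w(2)] by (simp add: inf.absorb2)
  then have eq: "convex_cone hull {w} = convex_cone hull (B \<inter> convex_cone hull {w})"
    by (rule face_of_simplicial_cone[OF lattice_part_finite[OF B(1)] _ convex_cone_hull_nonempty])
  moreover have "w \<in> convex_cone hull {w}" by (simp add: hull_inc)
  ultimately have "B \<inter> convex_cone hull {w} \<noteq> {}"
    using lattice_part_nonzero[OF w(1)] by fastforce
  then obtain b t where b: "b \<in> B" "0 \<le> t" "b = t *\<^sub>R w"
    by (auto simp: convex_cone_hull_singleton)
  have lpb: "lattice_part {b}" using lattice_part_subset[OF B(1)] b(1) by simp
  then have "t \<noteq> 0" using lattice_part_nonzero b(3) by fastforce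
  then have "s *\<^sub>R w = (s / t) *\<^sub>R b" "0 \<le> s \<Longrightarrow> 0 \<le> s / t" for s using b by auto
  then have "convex_cone hull {w} \<subseteq> convex_cone hull {b}"
    unfolding convex_cone_hull_singleton by blast
  moreover have "convex_cone hull {b} \<subseteq> convex_cone hull {w}"
    unfolding convex_cone_hull_singleton b(3) using b(2) by force
  ultimately have "b = w"
    by (intro lattice_ray_inject[OF lpb w(1)] subset_antisym)
  then show ?thesis using b(1) by simp
qed

text \<open>
  The primitive vectors of the rays are among the generators of \<open>\<sigma>\<close>, so they span a face of \<open>\<sigma>\<close>.
\<close>

lemma rays_of_cone_span_cone:
  assumes fan: "unimodular_fan \<Sigma>" and "\<sigma> \<in> \<Sigma>"
    and S: "S \<subseteq> fan_rays {0} \<Sigma>" "\<And>\<rho>. \<rho> \<in> S \<Longrightarrow> \<rho> \<subseteq> \<sigma>"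
  shows "convex_cone hull ({0} \<union> \<Union>S) \<in> \<Sigma>"
proof -
  obtain B where B: "lattice_part B" "\<sigma> = convex_cone hull B"
    using unimodular_fan_cone[OF fan \<open>\<sigma> \<in> \<Sigma>\<close>] .
  have gen: "\<exists>b\<in>B. \<rho> = convex_cone hull {b}" if \<rho>: "\<rho> \<in> S" for \<rho>
  proof -
    obtain w where w: "lattice_part {w}" "\<rho> = convex_cone hull {w}" "\<rho> \<in> \<Sigma>"
      using S(1) \<rho> fan_rays_iff[OF fan] by blast
    have "w \<in> convex_cone hull B" using S(2)[OF \<rho>] w(2) B(2) by (simp add: hull_inc subset_iff)
    then have "w \<in> B" using ray_in_cone_generator[OF fan B(1)] w B(2) \<open>\<sigma> \<in> \<Sigma>\<close> by blast
    then show ?thesis using w by blast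
  qed
  let ?C = "{b \<in> B. convex_cone hull {b} \<in> S}"
  have "convex_cone hull ({0} \<union> \<Union>S) = convex_cone hull ?C"
  proof (intro subset_antisym hull_minimal convex_cone_convex_cone_hull)
    have "\<rho> \<subseteq> convex_cone hull ?C" if \<rho>: "\<rho> \<in> S" for \<rho>
    proof -
      obtain b where b: "b \<in> B" "\<rho> = convex_cone hull {b}" using gen[OF \<rho>] by blast
      have "{b} \<subseteq> ?C" using b \<rho> by simp
      then show ?thesis unfolding b(2) by (rule hull_mono)
    qed
    then show "{0} \<union> \<Union>S \<subseteq> convex_cone hull ?C"
      by (auto simp: convex_cone_hull_contains_0)
    show "?C \<subseteq> convex_cone hull ({0} \<union> \<Union>S)"
    proof
      fix b assume b: "b \<in> ?C"
      have "b \<in> convex_cone hull {b}" by (simp add: hull_inc)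
      then show "b \<in> convex_cone hull ({0} \<union> \<Union>S)" using b by (intro hull_inc) auto
    qed
  qed
  moreover have "convex_cone hull ?C face_of \<sigma>"
    unfolding B(2) using B(1)
    by (intro simplicial_cone_face lattice_part_independent lattice_part_finite) auto
  ultimately show ?thesis
    using unimodular_fan_face[OF fan \<open>\<sigma> \<in> \<Sigma>\<close> _ convex_cone_hull_nonempty] by simp
qed

locale fan_with_ray =
  fixes \<Sigma> :: "(real ^ 'n) set set" and r :: "real ^ 'n"
  assumes fan: "unimodular_fan \<Sigma>" and r: "lattice_part {r}" "convex_cone hull {r} \<in> \<Sigma>"
begin

abbreviation R :: "(real ^ 'n) set" where "R \<equiv> convex_cone hull {r}"

text \<open>
  The star of the ray \<open>R\<close> lives in the quotient by \<open>span {r}\<close> and is represented by preimages, that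
  is by the sums of the cones containing \<open>r\<close> with that line.
\<close>

definition ray_star :: "(real ^ 'n) set set" where
  "ray_star = {cone_sum \<sigma> (span {r}) | \<sigma>. \<sigma> \<in> \<Sigma> \<and> r \<in> \<sigma>}"

definition ray_link :: "(real ^ 'n) set set" where
  "ray_link = {\<rho> \<in> fan_rays {0} \<Sigma>. \<rho> \<noteq> R \<and> cone_sum \<rho> R \<in> \<Sigma>}"

lemma finite_rays: "finite (fan_rays {0} \<Sigma>)" "finite ray_link"
  using fan by (auto simp: unimodular_fan_def fan_rays_def ray_link_def)

lemma R_ray: "R \<in> fan_rays {0} \<Sigma>"
  using fan_rays_iff[OF fan] r by blast

lemma cone_generators:
  assumes "\<sigma> \<in> \<Sigma>" "r \<in> \<sigma>"
  obtains B where "lattice_part B" "\<sigma> = convex_cone hull B" "r \<in> B"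
proof -
  obtain B where "lattice_part B" "\<sigma> = convex_cone hull B"
    using unimodular_fan_cone[OF fan assms(1)] .
  then show ?thesis using that ray_in_cone_generator[OF fan _ _ r] assms by blast
qed

lemma convex_cone_of_fan: "\<sigma> \<in> \<Sigma> \<Longrightarrow> convex_cone \<sigma>"
  by (rule unimodular_fan_cone[OF fan], assumption) (simp add: convex_cone_convex_cone_hull)

text \<open>
  Cones containing \<open>R\<close> can be compared after passing to the quotient by \<open>span {r}\<close>.  The sum of the
  generators of \<open>\<sigma>\<close> is a relatively interior point; moving it far enough in the direction \<open>r\<close> keeps
  it there and brings it into \<open>\<sigma>'\<close>.  So the face \<open>\<sigma> \<inter> \<sigma>'\<close> of \<open>\<sigma>\<close> meets the relative interior of
  \<open>\<sigma>\<close> and is all of \<open>\<sigma>\<close>.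
\<close>

lemma subset_of_star_subset:
  assumes \<sigma>: "\<sigma> \<in> \<Sigma>" "r \<in> \<sigma>" and \<sigma>': "\<sigma>' \<in> \<Sigma>" "r \<in> \<sigma>'"
    and sub: "\<sigma> \<subseteq> cone_sum \<sigma>' (span {r})"
  shows "\<sigma> \<subseteq> \<sigma>'"
proof -
  obtain B where B: "lattice_part B" "\<sigma> = convex_cone hull B" using cone_generators[OF \<sigma>] .
  have K: "convex_cone \<sigma>" "convex_cone \<sigma>'" using convex_cone_of_fan \<sigma> \<sigma>' by blast+
  have BS: "B \<subseteq> \<sigma>" unfolding B(2) by (rule hull_subset)
  have "\<Sum>B \<in> \<sigma>" using convex_cone_sum_mem[OF K(1), of B "\<lambda>b. b"] BS by auto
  then have "\<Sum>B \<in> cone_sum \<sigma>' (span {r})" using sub by blast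
  then obtain s t where st: "s \<in> \<sigma>'" "\<Sum>B = s + t *\<^sub>R r"
    by (auto simp: cone_sum_def span_singleton)
  let ?u = "\<Sum>B + \<bar>t\<bar> *\<^sub>R r"
  have "?u = s + (t + \<bar>t\<bar>) *\<^sub>R r" using st(2) by (simp add: algebra_simps)
  then have "?u \<in> \<sigma>'"
    using convex_cone_add[OF K(2) st(1) convex_cone_scaleR[OF K(2) _ \<sigma>'(2), of "t + \<bar>t\<bar>"]] by simp
  moreover have "\<bar>t\<bar> *\<^sub>R r \<in> \<sigma>" using convex_cone_scaleR[OF K(1) _ \<sigma>(2)] by simp
  ultimately have u: "?u \<in> \<sigma> \<inter> \<sigma>'"
    using convex_cone_add[OF K(1)] \<open>\<Sum>B \<in> \<sigma>\<close> by simp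
  have face: "(\<sigma> \<inter> \<sigma>') face_of \<sigma>" using unimodular_fan_Int[OF fan \<sigma>(1) \<sigma>'(1)] .
  have "b \<in> \<sigma>'" if b: "b \<in> B" for b
  proof -
    have "\<Sum>(B - {b}) \<in> \<sigma>"
      using convex_cone_sum_mem[OF K(1), of "B - {b}" "\<lambda>b. b"] BS by auto
    then have "\<Sum>(B - {b}) + \<bar>t\<bar> *\<^sub>R r \<in> \<sigma>"
      using convex_cone_add[OF K(1)] \<open>\<bar>t\<bar> *\<^sub>R r \<in> \<sigma>\<close> by simp
    moreover have "?u = b + (\<Sum>(B - {b}) + \<bar>t\<bar> *\<^sub>R r)"
      using sum.remove[OF lattice_part_finite[OF B(1)] b, of "\<lambda>b. b"] by simp
    then have "b + (\<Sum>(B - {b}) + \<bar>t\<bar> *\<^sub>R r) \<in> \<sigma> \<inter> \<sigma>'" using u by (simp only:)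
    moreover have "b \<in> \<sigma>" using b BS by blast
    ultimately show ?thesis
      using face_of_convex_cone_summand[OF K(1) face] by blast
  qed
  then show ?thesis unfolding B(2) by (intro hull_minimal K(2)) auto
qed

lemma star_cone_eqD:
  assumes "\<sigma> \<in> \<Sigma>" "r \<in> \<sigma>" "\<sigma>' \<in> \<Sigma>" "r \<in> \<sigma>'"
    and "cone_sum \<sigma> (span {r}) = cone_sum \<sigma>' (span {r})"
  shows "\<sigma> = \<sigma>'"
  using assms subset_of_star_subset[of \<sigma> \<sigma>'] subset_of_star_subset[of \<sigma>' \<sigma>]
    subset_cone_sum[OF span_zero, of \<sigma> "{r}"] subset_cone_sum[OF span_zero, of \<sigma>' "{r}"] by blast

lemma ray_linkE:
  assumes "\<rho> \<in> ray_link"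
  obtains w where "lattice_part {w, r}" "w \<noteq> r" "\<rho> = convex_cone hull {w}"
    "cone_sum \<rho> R = convex_cone hull {w, r}" "convex_cone hull {w, r} \<in> \<Sigma>"
proof -
  obtain w where w: "lattice_part {w}" "\<rho> = convex_cone hull {w}" "\<rho> \<in> \<Sigma>" "\<rho> \<noteq> R" "cone_sum \<rho> R \<in> \<Sigma>"
    using assms fan_rays_iff[OF fan] unfolding ray_link_def by blast
  have eq: "cone_sum \<rho> R = convex_cone hull {w, r}"
    unfolding w(2) cone_sum_convex_cone_hull by (simp add: insert_commute)
  then have \<sigma>: "convex_cone hull {w, r} \<in> \<Sigma>" using w(5) by simp
  obtain B where B: "lattice_part B" "convex_cone hull {w, r} = convex_cone hull B" "r \<in> B"
    by (rule cone_generators[OF \<sigma>]) (simp_all add: hull_inc)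
  have "w \<in> B"
  proof (rule ray_in_cone_generator[OF fan B(1) _ w(1)])
    show "w \<in> convex_cone hull B" unfolding B(2)[symmetric] by (simp add: hull_inc)
  qed (use B \<sigma> w in auto)
  then have "lattice_part {w, r}" using lattice_part_subset[OF B(1)] B(3) by simp
  moreover have "w \<noteq> r" using w by blast
  ultimately show ?thesis using that w(2) eq \<sigma> by blast
qed

lemma link_cone_in_star:
  assumes "\<rho> \<in> ray_link"
  shows "cone_sum (cone_sum \<rho> R) (span {r}) = cone_sum \<rho> (span {r})"
    "r \<in> cone_sum \<rho> R" "\<rho> \<subseteq> cone_sum \<rho> R"
    "cone_sum \<rho> R \<in> \<Sigma>" "cone_sum \<rho> (span {r}) \<in> ray_star"
proof -
  show eq: "cone_sum (cone_sum \<rho> R) (span {r}) = cone_sum \<rho> (span {r})"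
    by (intro cone_sum_span_absorb convex_cone_hull_contains_0 convex_cone_hull_subset_span)
  obtain w where "cone_sum \<rho> R = convex_cone hull {w, r}" using ray_linkE[OF assms] .
  then show rin: "r \<in> cone_sum \<rho> R" by (simp add: hull_inc)
  show "\<rho> \<subseteq> cone_sum \<rho> R" by (intro subset_cone_sum convex_cone_hull_contains_0)
  show "cone_sum \<rho> R \<in> \<Sigma>" using assms by (simp add: ray_link_def)
  with rin eq show "cone_sum \<rho> (span {r}) \<in> ray_star"
    unfolding ray_star_def by blast
qed

text \<open>
  The rays of the star correspond to the two-dimensional cones containing \<open>R\<close>.  Injectivity is
  the recovery of such a cone from its image in the quotient.  For surjectivity, a cone whose image
  is a ray has exactly one generator besides \<open>r\<close>: a second one would be a combination of the first
  and \<open>r\<close>.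
\<close>

lemma bij_betw_link_rays:
  "bij_betw (\<lambda>\<rho>. cone_sum \<rho> (span {r})) ray_link (fan_rays (span {r}) ray_star)"
proof (rule bij_betw_imageI[OF inj_onI equalityI[OF subsetI subsetI]])
  fix \<rho> \<rho>' assume \<rho>: "\<rho> \<in> ray_link" "\<rho>' \<in> ray_link"
    and eqT: "cone_sum \<rho> (span {r}) = cone_sum \<rho>' (span {r})"
  have eq: "cone_sum \<rho> R = cone_sum \<rho>' R"
  proof (rule star_cone_eqD)
    show "cone_sum (cone_sum \<rho> R) (span {r}) = cone_sum (cone_sum \<rho>' R) (span {r})"
      using eqT \<rho> by (simp only: link_cone_in_star(1))
  qed (use \<rho> in \<open>auto intro: link_cone_in_star\<close>)
  obtain w where w: "lattice_part {w, r}" "w \<noteq> r" "\<rho> = convex_cone hull {w}"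
    "cone_sum \<rho> R = convex_cone hull {w, r}" using ray_linkE[OF \<rho>(1)] .
  obtain w' where w': "lattice_part {w', r}" "\<rho>' = convex_cone hull {w'}"
    "cone_sum \<rho>' R = convex_cone hull {w', r}" "convex_cone hull {w', r} \<in> \<Sigma>"
    using ray_linkE[OF \<rho>(2)] .
  have "w \<in> {w', r}"
  proof (rule ray_in_cone_generator[OF fan w'(1,4)])
    show "lattice_part {w}" using lattice_part_subset[OF w(1)] by simp
    show "convex_cone hull {w} \<in> \<Sigma>" using \<rho>(1) w(3) by (simp add: ray_link_def fan_rays_def)
    have "w \<in> convex_cone hull {w, r}" by (simp add: hull_inc)
    then show "w \<in> convex_cone hull {w', r}" using eq w(4) w'(3) by simp
  qed
  then show "\<rho> = \<rho>'" using w w' by simp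
next
  fix \<rho>' assume "\<rho>' \<in> (\<lambda>\<rho>. cone_sum \<rho> (span {r})) ` ray_link"
  then obtain \<rho> where \<rho>: "\<rho> \<in> ray_link" "\<rho>' = cone_sum \<rho> (span {r})" by blast
  obtain w where w: "lattice_part {w, r}" "w \<noteq> r" "\<rho> = convex_cone hull {w}"
    using ray_linkE[OF \<rho>(1)] .
  have "\<rho>' = {t *\<^sub>R w + u | t u. 0 \<le> t \<and> u \<in> span {r}}"
    unfolding \<rho>(2) w(3) cone_sum_def convex_cone_hull_singleton by blast
  moreover have "\<rho>' \<in> ray_star" using link_cone_in_star(5)[OF \<rho>(1)] \<rho>(2) by simp
  ultimately show "\<rho>' \<in> fan_rays (span {r}) ray_star"
    by (intro fan_raysI[OF _ lattice_part_not_in_span[OF w(1,2)]])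
next
  fix \<rho>' assume "\<rho>' \<in> fan_rays (span {r}) ray_star"
  then obtain v where "\<rho>' \<in> ray_star" "v \<notin> span {r}"
    and half: "\<rho>' = {t *\<^sub>R v + u | t u. 0 \<le> t \<and> u \<in> span {r}}"
    by (rule fan_raysE)
  then obtain \<sigma> where \<sigma>: "\<sigma> \<in> \<Sigma>" "r \<in> \<sigma>" "\<rho>' = cone_sum \<sigma> (span {r})" "v \<notin> span {r}"
    unfolding ray_star_def by blast
  obtain B where B: "lattice_part B" "\<sigma> = convex_cone hull B" "r \<in> B"
    using cone_generators[OF \<sigma>(1,2)] .
  have in_half: "\<exists>t s. b = t *\<^sub>R v + s *\<^sub>R r" if "b \<in> B" for b
  proof -
    have "b \<in> \<sigma>" unfolding B(2) using that by (rule hull_inc)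
    then have "b \<in> \<rho>'"
      using \<sigma>(3) subset_cone_sum[OF span_zero, of \<sigma> "{r}"] by blast
    then show ?thesis unfolding half by (auto simp: span_singleton)
  qed
  have "v \<in> \<rho>'"
    unfolding half by (intro CollectI exI[of _ 1] exI[of _ 0]) (simp add: span_zero)
  have "B \<noteq> {r}"
  proof
    assume "B = {r}"
    then have "\<sigma> \<subseteq> span {r}" using convex_cone_hull_subset_span[of B] B(2) by simp
    then have "cone_sum \<sigma> (span {r}) \<subseteq> span {r}"
      by (auto simp: cone_sum_def intro!: span_add)
    then show False using \<open>v \<in> \<rho>'\<close> \<sigma> by blast
  qed
  then obtain w where w: "w \<in> B" "w \<noteq> r" using B(3) by blast
  have w_span: "w \<notin> span {r}"
    using lattice_part_not_in_span[OF lattice_part_subset[OF B(1)]] w B(3) by simp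
  have "b \<in> {w, r}" if b: "b \<in> B" for b
  proof (rule ccontr)
    assume new: "b \<notin> {w, r}"
    have "lattice_part (insert b {w, r})"
      by (rule lattice_part_subset[OF B(1)]) (use b w B(3) in auto)
    then have b_span: "b \<notin> span {w, r}"
      using lattice_part_independent[of "insert b {w, r}"] new by (simp add: independent_insert)
    obtain t s t' s' where eq: "w = t *\<^sub>R v + s *\<^sub>R r" "b = t' *\<^sub>R v + s' *\<^sub>R r"
      using in_half b w by blast
    have "t \<noteq> 0" using eq(1) w_span span_base span_scale by force
    then have "v = (1 / t) *\<^sub>R w - (s / t) *\<^sub>R r" unfolding eq(1) by (simp add: algebra_simps)
    then have "v \<in> span {w, r}" by (simp add: span_base span_diff span_scale)
    then have "b \<in> span {w, r}" unfolding eq(2) by (simp add: span_base span_add span_scale)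
    then show False using b_span by blast
  qed
  then have BB: "B = {w, r}" using w B(3) by blast
  let ?\<rho> = "convex_cone hull {w}"
  have sum: "cone_sum ?\<rho> R = \<sigma>"
    unfolding cone_sum_convex_cone_hull B(2) BB by (simp add: insert_commute)
  have "?\<rho> face_of \<sigma>"
    unfolding B(2) using B(1) w
    by (intro simplicial_cone_face lattice_part_independent lattice_part_finite) auto
  then have "?\<rho> \<in> \<Sigma>"
    by (rule unimodular_fan_face[OF fan \<sigma>(1) _ convex_cone_hull_nonempty])
  moreover have lpw: "lattice_part {w}" using lattice_part_subset[OF B(1)] w by simp
  moreover have "?\<rho> \<noteq> R" using lattice_ray_inject[OF lpw r(1)] w by blast
  ultimately have "?\<rho> \<in> ray_link"
    unfolding ray_link_def using fan_rays_iff[OF fan] sum \<sigma>(1) by blast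
  moreover have "\<rho>' = cone_sum ?\<rho> (span {r})"
    using link_cone_in_star(1)[OF \<open>?\<rho> \<in> ray_link\<close>] sum \<sigma>(3) by simp
  ultimately show "\<rho>' \<in> (\<lambda>\<rho>. cone_sum \<rho> (span {r})) ` ray_link" by blast
qed

lemma ray_gen_star:
  assumes "\<rho> \<in> ray_link"
  shows "ray_gen (span {r}) (cone_sum \<rho> (span {r})) - ray_gen {0} \<rho> \<in> span {r}"
proof -
  obtain w where w: "lattice_part {w, r}" "w \<noteq> r" "\<rho> = convex_cone hull {w}"
    using ray_linkE[OF assms] .
  have "ray_gen {0} \<rho> = w"
    unfolding w(3) by (rule ray_gen_ray) (use lattice_part_subset[OF w(1)] in simp)
  then show ?thesis
    using ray_gen_mod[OF w(1)] w(2,3) by simp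
qed

text \<open>
  If the images of some link rays span a cone of the star, the rays themselves, with or without \<open>R\<close>,
  lie in one cone of the fan and therefore span a face of it.  The contrapositive turns a
  nonface monomial of the fan into a nonface monomial of the star.
\<close>

lemma star_nonface:
  assumes S: "S \<subseteq> ray_link"
    and face: "convex_cone hull (span {r} \<union> (\<Union>\<rho>\<in>S. cone_sum \<rho> (span {r}))) \<in> ray_star"
  shows "convex_cone hull ({0} \<union> \<Union>S) \<in> \<Sigma>" "convex_cone hull ({0} \<union> \<Union>(insert R S)) \<in> \<Sigma>"
proof -
  obtain \<sigma> where \<sigma>: "\<sigma> \<in> \<Sigma>" "r \<in> \<sigma>"
    and eq: "convex_cone hull (span {r} \<union> (\<Union>\<rho>\<in>S. cone_sum \<rho> (span {r}))) = cone_sum \<sigma> (span {r})"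
    using face unfolding ray_star_def by blast
  have sub: "\<rho> \<subseteq> \<sigma>" if \<rho>: "\<rho> \<in> S" for \<rho>
  proof -
    have \<rho>l: "\<rho> \<in> ray_link" using S \<rho> by blast
    have "cone_sum \<rho> R \<subseteq> cone_sum \<rho> (span {r})"
      using subset_cone_sum[OF span_zero, of "cone_sum \<rho> R" "{r}"] link_cone_in_star(1)[OF \<rho>l] by simp
    also have "\<dots> \<subseteq> cone_sum \<sigma> (span {r})"
      unfolding eq[symmetric] using \<rho> by (intro subsetI hull_inc) blast
    finally have "cone_sum \<rho> R \<subseteq> \<sigma>"
      using subset_of_star_subset[OF _ _ \<sigma>] link_cone_in_star[OF \<rho>l] by blast
    then show ?thesis using link_cone_in_star(3)[OF \<rho>l] by blast
  qed
  have "R \<subseteq> \<sigma>"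
    using \<sigma>(2) by (intro hull_minimal convex_cone_of_fan \<sigma>(1)) simp
  have "S \<subseteq> fan_rays {0} \<Sigma>" using S by (auto simp: ray_link_def)
  then show "convex_cone hull ({0} \<union> \<Union>S) \<in> \<Sigma>"
    by (rule rays_of_cone_span_cone[OF fan \<sigma>(1)]) (rule sub)
  show "convex_cone hull ({0} \<union> \<Union>(insert R S)) \<in> \<Sigma>"
  proof (rule rays_of_cone_span_cone[OF fan \<sigma>(1)])
    show "insert R S \<subseteq> fan_rays {0} \<Sigma>" using \<open>S \<subseteq> fan_rays {0} \<Sigma>\<close> R_ray by simp
    show "\<rho> \<subseteq> \<sigma>" if "\<rho> \<in> insert R S" for \<rho> using that \<open>R \<subseteq> \<sigma>\<close> sub by auto
  qed
qed

end

section \<open>The restriction homomorphism to the star of a ray\<close>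

context fan_with_ray
begin

text \<open>
  The images of the variables under the restriction to the star of \<open>R\<close>, where \<open>f\<close> is the linear form
  normalised by \<open>f r = 1\<close>.
\<close>

definition subst_var :: "(real ^ 'n \<Rightarrow> real) \<Rightarrow> (real ^ 'n) set \<Rightarrow> (real ^ 'n) set rpoly" where
  "subst_var f \<rho> =
     (if \<rho> = R then
        - (\<Sum>\<rho>'\<in>ray_link. pconst (f (ray_gen {0} \<rho>')) * pvar (cone_sum \<rho>' (span {r})))
      else if \<rho> \<in> ray_link then pvar (cone_sum \<rho> (span {r}))
      else 0)"

lemma link_ray_in_star_rays:
  "\<rho> \<in> ray_link \<Longrightarrow> cone_sum \<rho> (span {r}) \<in> fan_rays (span {r}) ray_star"
  using bij_betw_apply[OF bij_betw_link_rays] .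

lemma R_notin_link: "R \<notin> ray_link"
  by (simp add: ray_link_def)

lemma subst_var_closed: "subst_var f \<rho> \<in> carrier (poly_ring (fan_rays (span {r}) ray_star))"
  unfolding subst_var_def
  by (auto intro!: poly_ring_uminus_closed poly_ring_sum_closed poly_ring_closed link_ray_in_star_rays)

text \<open>
  If \<open>g r = 0\<close>, the auxiliary form \<open>f\<close> drops out of the right-hand side.
\<close>

lemma subst_ray_sum:
  "poly_subst (subst_var f) (ray_sum {0} \<Sigma> g) =
     (\<Sum>\<rho>\<in>ray_link. pconst (g (ray_gen {0} \<rho>) - g r * f (ray_gen {0} \<rho>)) *
        pvar (cone_sum \<rho> (span {r})))"
proof -
  let ?x = "\<lambda>\<rho>. pvar (cone_sum \<rho> (span {r})) :: (real ^ 'n) set rpoly"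
  let ?g = "\<lambda>\<rho>. g (ray_gen {0} \<rho>)" and ?f = "\<lambda>\<rho>. f (ray_gen {0} \<rho>)"
  have "poly_subst (subst_var f) (ray_sum {0} \<Sigma> g) =
      (\<Sum>\<rho>\<in>fan_rays {0} \<Sigma>. pconst (?g \<rho>) * subst_var f \<rho>)"
    by (simp add: ray_sum_def poly_subst_sum poly_subst_mult)
  also have "\<dots> = (\<Sum>\<rho>\<in>insert R ray_link. pconst (?g \<rho>) * subst_var f \<rho>)"
    using finite_rays R_ray
    by (intro sum.mono_neutral_right) (auto simp: subst_var_def ray_link_def)
  also have "\<dots> = pconst (g r) * subst_var f R + (\<Sum>\<rho>\<in>ray_link. pconst (?g \<rho>) * subst_var f \<rho>)"
    using finite_rays R_notin_link by (simp add: ray_gen_ray[OF r(1)])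
  also have "(\<Sum>\<rho>\<in>ray_link. pconst (?g \<rho>) * subst_var f \<rho>) = (\<Sum>\<rho>\<in>ray_link. pconst (?g \<rho>) * ?x \<rho>)"
    using R_notin_link by (intro sum.cong) (auto simp: subst_var_def)
  also have "pconst (g r) * subst_var f R = - (\<Sum>\<rho>\<in>ray_link. pconst (g r) * (pconst (?f \<rho>) * ?x \<rho>))"
    by (simp add: subst_var_def sum_distrib_left)
  also have "- (\<Sum>\<rho>\<in>ray_link. pconst (g r) * (pconst (?f \<rho>) * ?x \<rho>)) + (\<Sum>\<rho>\<in>ray_link. pconst (?g \<rho>) * ?x \<rho>) =
      (\<Sum>\<rho>\<in>ray_link. pconst (?g \<rho> - g r * ?f \<rho>) * ?x \<rho>)"
    by (simp add: pconst_diff pconst_mult algebra_simps sum_subtractf)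
  finally show ?thesis .
qed

lemma sum_star_rays:
  "(\<Sum>\<rho>\<in>fan_rays (span {r}) ray_star. h \<rho>) = (\<Sum>\<rho>\<in>ray_link. h (cone_sum \<rho> (span {r})))"
  using sum.reindex_bij_betw[OF bij_betw_link_rays, of h] by simp

lemma linear_form_ray_gen_star:
  assumes "linear_form (span {r}) m" "\<rho> \<in> ray_link"
  shows "m (ray_gen (span {r}) (cone_sum \<rho> (span {r}))) = m (ray_gen {0} \<rho>)"
proof -
  have "m (ray_gen (span {r}) (cone_sum \<rho> (span {r})) - ray_gen {0} \<rho>) = 0"
    using assms(1) ray_gen_star[OF assms(2)] by (simp add: linear_form_def)
  then show ?thesis using assms(1) by (simp add: linear_form_def linear_diff)
qed

text \<open>
  The relation of \<open>g\<close> goes to the relation of \<open>g - g r * f\<close>, a linear form that vanishes on \<open>r\<close> and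
  thus lives on the quotient.
\<close>

lemma subst_linear_relation:
  assumes f: "linear_form {0} f" "f r = 1" and g: "linear_form {0} g"
  shows "poly_subst (subst_var f) (ray_sum {0} \<Sigma> g) \<in> chow_ideal (span {r}) ray_star"
proof -
  let ?m = "\<lambda>x. g x - g r * f x"
  have lin: "linear ?m"
    using f g by (intro linear_compose_sub linear_compose_scale_right[of f "g r", simplified])
      (auto simp: linear_form_def)
  have m: "linear_form (span {r}) ?m"
    unfolding linear_form_def
  proof (intro conjI ballI lin)
    fix w assume "w \<in> span {r}"
    then obtain t where "w = t *\<^sub>R r" by (auto simp: span_singleton)
    then show "?m w = 0" using linear_cmul[OF lin, of t r] f(2) by simp
  qed
  have "poly_subst (subst_var f) (ray_sum {0} \<Sigma> g) = ray_sum (span {r}) ray_star ?m"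
    unfolding subst_ray_sum ray_sum_def[of "span {r}"] sum_star_rays
    using linear_form_ray_gen_star[OF m] by (intro sum.cong) auto
  then show ?thesis using chow_ideal_linear[OF m] by simp
qed

text \<open>
  A factor whose ray is neither \<open>R\<close> nor in the link maps to \<open>0\<close>.  Otherwise the factors different
  from \<open>x\<^sub>R\<close> already map to a nonface monomial of the star, and the image of \<open>x\<^sub>R\<close> only multiplies it.
\<close>

lemma subst_nonface_relation:
  assumes S: "S \<subseteq> fan_rays {0} \<Sigma>" "convex_cone hull ({0} \<union> \<Union>S) \<notin> \<Sigma>"
  shows "poly_subst (subst_var f) (\<Prod>\<rho>\<in>S. pvar \<rho>) \<in> chow_ideal (span {r}) ray_star"
proof -
  note I = poly_ring_ideal_closed[OF ideal_chow_ideal[of "span {r}" ray_star, unfolded chow_poly_ring_def]]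
  have finS: "finite S" using S(1) finite_rays finite_subset by blast
  have eq: "poly_subst (subst_var f) (\<Prod>\<rho>\<in>S. pvar \<rho>) = (\<Prod>\<rho>\<in>S. subst_var f \<rho>)"
    by (simp add: poly_subst_prod)
  show ?thesis
  proof (cases "S - {R} \<subseteq> ray_link")
    case False
    then obtain \<rho> where "\<rho> \<in> S" "\<rho> \<noteq> R" "\<rho> \<notin> ray_link" by blast
    then have "(\<Prod>\<rho>\<in>S. subst_var f \<rho>) = 0"
      using finS by (intro prod_zero bexI[of _ \<rho>]) (auto simp: subst_var_def)
    then show ?thesis using eq I(1) by simp
  next
    case True
    let ?h = "\<lambda>\<rho>. cone_sum \<rho> (span {r})"
    let ?S = "?h ` (S - {R})"
    have "convex_cone hull (span {r} \<union> (\<Union>\<rho>\<in>S - {R}. ?h \<rho>)) \<notin> ray_star"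
    proof
      assume *: "convex_cone hull (span {r} \<union> (\<Union>\<rho>\<in>S - {R}. ?h \<rho>)) \<in> ray_star"
      show False
        using star_nonface[OF True *] S(2) by (cases "R \<in> S") (simp_all add: insert_absorb)
    qed
    moreover have "?S \<subseteq> fan_rays (span {r}) ray_star"
      using True link_ray_in_star_rays by blast
    ultimately have "(\<Prod>\<rho>\<in>?S. pvar \<rho>) \<in> chow_ideal (span {r}) ray_star"
      by (intro chow_ideal_nonface)
    moreover have "(\<Prod>\<rho>\<in>?S. pvar \<rho>) = (\<Prod>\<rho>\<in>S - {R}. pvar (?h \<rho>) :: (real ^ 'n) set rpoly)"
      using inj_on_subset[OF bij_betw_imp_inj_on[OF bij_betw_link_rays] True]
      by (simp add: prod.reindex)
    moreover have "(\<Prod>\<rho>\<in>S - {R}. pvar (?h \<rho>)) = (\<Prod>\<rho>\<in>S - {R}. subst_var f \<rho>)"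
      using True by (intro prod.cong) (auto simp: subst_var_def)
    ultimately have rest: "(\<Prod>\<rho>\<in>S - {R}. subst_var f \<rho>) \<in> chow_ideal (span {r}) ray_star" by simp
    show ?thesis
    proof (cases "R \<in> S")
      case True
      then have "(\<Prod>\<rho>\<in>S. subst_var f \<rho>) = subst_var f R * (\<Prod>\<rho>\<in>S - {R}. subst_var f \<rho>)"
        using finS by (intro prod.remove)
      then show ?thesis using eq I(5)[OF rest subst_var_closed] by simp
    next
      case False
      then show ?thesis using eq rest by simp
    qed
  qed
qed

lemma subst_chow_ideal:
  assumes f: "linear_form {0} f" "f r = 1" and i: "i \<in> chow_ideal {0} \<Sigma>"
  shows "poly_subst (subst_var f) i \<in> chow_ideal (span {r}) ray_star"
proof -
  let ?I = "chow_ideal (span {r}) ray_star"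
  let ?J = "{p \<in> carrier (poly_ring (fan_rays {0} \<Sigma>)). poly_subst (subst_var f) p \<in> ?I}"
  have "chow_ideal {0} \<Sigma> \<subseteq> ?J"
  proof (rule chow_ideal_least)
    show "ideal ?J (chow_poly_ring {0} \<Sigma>)"
      unfolding chow_poly_ring_def
      by (intro ideal_vimage_poly_subst[OF ideal_chow_ideal[unfolded chow_poly_ring_def]] subst_var_closed)
  next
    fix S assume S: "S \<subseteq> fan_rays {0} \<Sigma>" "convex_cone hull ({0} \<union> \<Union>S) \<notin> \<Sigma>"
    have "(\<Prod>\<rho>\<in>S. pvar \<rho>) \<in> carrier (poly_ring (fan_rays {0} \<Sigma>))"
      using S(1) by (intro poly_ring_prod_closed) auto
    then show "(\<Prod>\<rho>\<in>S. pvar \<rho>) \<in> ?J" using subst_nonface_relation[OF S] by simp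
  next
    fix g :: "real ^ 'n \<Rightarrow> real" assume "linear_form {0} g"
    then show "ray_sum {0} \<Sigma> g \<in> ?J"
      using subst_linear_relation[OF f] ray_sum_closed[of "{0}" \<Sigma> g] by (simp add: chow_poly_ring_def)
  qed
  then show ?thesis using i by blast
qed

end

section \<open>Unimodularity of star cones at vertices\<close>

text \<open>
  An involution mapping a lattice basis into the lattice maps the lattice onto itself, and hence
  the basis to a lattice basis.
\<close>

lemma lattice_basis_involution:
  fixes g :: "real ^ 'n \<Rightarrow> real ^ 'n"
  assumes B: "lattice_basis B" and g: "linear g" "\<And>x. g (g x) = x"
    and lat: "\<And>b. b \<in> B \<Longrightarrow> g b \<in> lattice_pts"
  shows "lattice_basis (g ` B)"
proof -
  have inj: "inj g" using g(2) by (rule inj_on_inverseI)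
  have fin: "finite B" and ind: "independent B" using B by (simp_all add: lattice_basis_def)
  have g_lat: "g z \<in> lattice_pts" if z: "z \<in> lattice_pts" for z
  proof -
    obtain c :: "_ \<Rightarrow> int" where "z = (\<Sum>b\<in>B. of_int (c b) *\<^sub>R b)"
      using z lattice_basis_pts_iff[OF B, of z] by blast
    then have "g z = (\<Sum>b\<in>B. of_int (c b) *\<^sub>R g b)"
      using g(1) by (simp add: linear_sum linear_cmul)
    then show ?thesis using lat by (auto intro!: lattice_pts_sum lattice_pts_closed)
  qed
  have comb: "(\<Sum>b\<in>g ` B. of_int (c b) *\<^sub>R b) = g (\<Sum>b\<in>B. of_int (c (g b)) *\<^sub>R b)" for c :: "_ \<Rightarrow> int"
    using g(1) inj_on_subset[OF inj] by (simp add: sum.reindex linear_sum linear_cmul)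
  have "z \<in> lattice_pts" if z: "z = (\<Sum>b\<in>g ` B. of_int (c b) *\<^sub>R b)" for z and c :: "_ \<Rightarrow> int"
    unfolding z comb by (intro g_lat lattice_pts_sum lattice_pts_closed) (use lattice_basis_subset_pts[OF B] in blast)
  moreover have "\<exists>c :: _ \<Rightarrow> int. z = (\<Sum>b\<in>g ` B. of_int (c b) *\<^sub>R b)" if z: "z \<in> lattice_pts" for z
  proof -
    obtain c :: "_ \<Rightarrow> int" where "g z = (\<Sum>b\<in>B. of_int (c b) *\<^sub>R b)"
      using g_lat[OF z] lattice_basis_pts_iff[OF B, of "g z"] by blast
    then have "z = g (\<Sum>b\<in>B. of_int (c (g (g b))) *\<^sub>R b)" using g(2)[of z] by (simp add: g(2))
    then show ?thesis by (intro exI[of _ "\<lambda>b. c (g b)"]) (simp only: comb)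
  qed
  ultimately have "{\<Sum>b\<in>g ` B. of_int (c b) *\<^sub>R b | c :: _ \<Rightarrow> int. True} = lattice_pts"
    by auto
  moreover have "independent (g ` B)"
    using linear_independent_injective_image[OF g(1) ind inj_on_subset[OF inj]] by simp
  ultimately show ?thesis unfolding lattice_basis_def using fin by simp
qed

text \<open>
  At a vertex \<open>x\<close> of \<open>conv(v\<^sub>0, \<dots>, v\<^sub>k) + cone(us)\<close> the star cone is generated by the edge vectors
  \<open>v - x\<close> and by \<open>us\<close>.  The hypothesis on lattice bases concerns the edge vectors at \<open>v\<^sub>0\<close>; those at
  another vertex are obtained from them by a linear involution of the lattice.
\<close>

lemma unimodular_star_cone:
  fixes P :: "(real ^ 'n) set"
  assumes "unimodular_polyhedron P" and x: "{x} face_of P"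
  obtains B where "lattice_part B" "star_cone {x} P = convex_cone hull B"
proof -
  obtain v0 vs us where lat: "v0 \<in> lattice_pts" "set vs \<subseteq> lattice_pts" "set us \<subseteq> lattice_pts"
    and part: "part_of_lattice_basis (map (\<lambda>v. v - v0) vs @ us)"
    and P: "P = {p + (\<Sum>u\<in>set us. c u *\<^sub>R u) | p c.
        p \<in> convex hull (insert v0 (set vs)) \<and> (\<forall>u. 0 \<le> (c u :: real))}"
    using assms(1) unfolding unimodular_polyhedron_def by auto
  let ?D = "insert v0 (set vs)"
  obtain B0 where B0: "(\<lambda>v. v - v0) ` set vs \<union> set us \<subseteq> B0" "lattice_basis B0"
    and disj: "(\<lambda>v. v - v0) ` set vs \<inter> set us = {}"
    using part unfolding part_of_lattice_basis_def by auto
  have P_I: "p + (\<Sum>u\<in>set us. c u *\<^sub>R u) \<in> P" if "p \<in> convex hull ?D" "\<And>u. 0 \<le> c u" for p c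
    unfolding P using that by blast
  have hullP: "convex hull ?D \<subseteq> P" using P_I[of _ "\<lambda>_. 0"] by auto
  have ext: "x extreme_point_of P" using x by (simp add: face_of_singleton)
  then have "x \<in> P" by (simp add: extreme_point_of_def)
  then obtain p c where p: "p \<in> convex hull ?D" "\<And>u. 0 \<le> c u" "x = p + (\<Sum>u\<in>set us. c u *\<^sub>R u)"
    unfolding P by blast
  let ?q = "\<Sum>u\<in>set us. c u *\<^sub>R u"
  have "?q = 0"
  proof (rule ccontr)
    assume q: "?q \<noteq> 0"
    have "p + 2 *\<^sub>R ?q \<in> P" using P_I[OF p(1), of "\<lambda>u. 2 * c u"] p(2) by (simp add: scaleR_sum_right)
    moreover have "x = (1 - 1/2) *\<^sub>R p + (1/2) *\<^sub>R (p + 2 *\<^sub>R ?q)"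
      unfolding p(3) by (simp add: scaleR_add_right flip: scaleR_add_left)
    then have "x \<in> open_segment p (p + 2 *\<^sub>R ?q)"
      unfolding in_segment using q by (intro conjI exI[of _ "1/2"]) auto
    ultimately show False using ext p(1) hullP unfolding extreme_point_of_def by blast
  qed
  then have x_hull: "x \<in> convex hull ?D" using p by simp
  have "x extreme_point_of (convex hull ?D)"
    using ext x_hull hullP unfolding extreme_point_of_def by blast
  then have xD: "x \<in> ?D" by (rule extreme_point_of_convex_hull)
  let ?B = "(\<lambda>v. v - x) ` (?D - {x}) \<union> set us"
  have "lattice_part ?B"
  proof (cases "x = v0")
    case True
    then show ?thesis unfolding lattice_part_def using B0 by (intro exI[of _ B0]) auto
  next
    case False
    \<comment> \<open>The involution is \<open>g z = z - l z *\<^sub>R (x - v0)\<close>, where \<open>l\<close> is \<open>2\<close> on \<open>x - v0\<close> and \<open>1\<close> on the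
      other edge vectors, so that \<open>g\<close> negates \<open>x - v0\<close>, takes \<open>v - v0\<close> to \<open>v - x\<close> and fixes \<open>us\<close>.\<close>
    let ?b0 = "x - v0" and ?C = "(\<lambda>v. v - v0) ` (set vs - {x})"
    have xvs: "x \<in> set vs" using xD False by simp
    have ind: "independent B0" using B0(2) by (simp add: lattice_basis_def)
    obtain l :: "real ^ 'n \<Rightarrow> real" where l: "linear l"
      "\<And>b. b \<in> B0 \<Longrightarrow> l b = (if b = ?b0 then 2 else if b \<in> ?C then 1 else 0)"
      using linear_independent_extend[OF ind, of "\<lambda>b. if b = ?b0 then 2 else if b \<in> ?C then 1 else (0::real)"]
      by blast
    define g where "g z = z - l z *\<^sub>R ?b0" for z
    have b0: "?b0 \<in> B0" using B0(1) xvs by blast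
    have "lattice_basis (g ` B0)"
    proof (rule lattice_basis_involution[OF B0(2)])
      show "linear g" unfolding g_def
        using l(1) by (intro linearI) (simp_all add: linear_add linear_cmul algebra_simps)
      show "g (g z) = z" for z
      proof -
        have "l (z - l z *\<^sub>R ?b0) = l z - l z * l ?b0"
          by (simp only: linear_diff[OF l(1)] linear_cmul[OF l(1)] real_scaleR_def)
        then have "l (g z) = - l z" using l(2)[OF b0] by (simp add: g_def)
        then show ?thesis unfolding g_def[of "g z"] by (simp add: g_def)
      qed
      show "g b \<in> lattice_pts" if b: "b \<in> B0" for b
      proof -
        have "g b = b + of_int (if b = ?b0 then - 2 else if b \<in> ?C then - 1 else 0) *\<^sub>R ?b0"
          unfolding g_def l(2)[OF b] by simp
        then show ?thesis using lattice_basis_subset_pts[OF B0(2)] b b0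
          by (auto simp only: intro!: lattice_pts_closed)
      qed
    qed
    moreover have "?B \<subseteq> g ` B0"
    proof
      fix b assume "b \<in> ?B"
      then consider "b = v0 - x" | v where "v \<in> set vs" "v \<noteq> x" "b = v - x" | "b \<in> set us" by blast
      then show "b \<in> g ` B0"
      proof cases
        case 1
        then have "b = g ?b0" using l(2)[OF b0] by (simp add: g_def algebra_simps scaleR_2)
        then show ?thesis using b0 by blast
      next
        case 2
        have v: "v - v0 \<in> B0" using 2 B0(1) by blast
        have "v - v0 \<in> ?C" "v - v0 \<noteq> ?b0" using 2 by auto
        then have "b = g (v - v0)" using l(2)[OF v] 2 by (simp add: g_def)
        then show ?thesis using v by blast
      next
        case 3
        then have bB: "b \<in> B0" using B0(1) by blast
        have "b \<notin> ?C" "b \<noteq> ?b0" using disj 3 xvs by blast+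
        then have "b = g b" using l(2)[OF bB] by (simp add: g_def)
        then show ?thesis using bB by blast
      qed
    qed
    ultimately show ?thesis unfolding lattice_part_def by blast
  qed
  moreover have "star_cone {x} P = convex_cone hull ?B"
    unfolding star_cone_def
  proof (intro subset_antisym hull_minimal convex_cone_convex_cone_hull)
    let ?K = "convex_cone hull ?B"
    show "{y - z | y z. y \<in> P \<and> z \<in> {x}} \<subseteq> ?K"
    proof clarify
      fix y assume "y \<in> P"
      then obtain p c where p: "p \<in> convex hull ?D" "\<And>u. 0 \<le> c u" "y = p + (\<Sum>u\<in>set us. c u *\<^sub>R u)"
        unfolding P by blast
      have "convex hull ?D \<subseteq> (+) x ` ?K"
      proof (rule hull_minimal)
        show "convex ((+) x ` ?K)" by (intro convex_translation convex_convex_cone_hull)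
        show "?D \<subseteq> (+) x ` ?K"
        proof
          fix v assume v: "v \<in> ?D"
          have "v - x \<in> ?K"
            using v by (cases "v = x") (auto simp: convex_cone_hull_contains_0 intro!: hull_inc)
          then show "v \<in> (+) x ` ?K" by (intro image_eqI[of _ _ "v - x"]) auto
        qed
      qed
      then have "p - x \<in> ?K" using p(1) by auto
      moreover have "(\<Sum>u\<in>set us. c u *\<^sub>R u) \<in> ?K"
        using p(2) by (intro convex_cone_sum_mem[OF convex_cone_convex_cone_hull] convex_cone_hull_mul hull_inc) auto
      ultimately have "(p - x) + (\<Sum>u\<in>set us. c u *\<^sub>R u) \<in> ?K" by (rule convex_cone_hull_add)
      then show "y - x \<in> ?K" unfolding p(3) by (simp add: algebra_simps)
    qed
    show "?B \<subseteq> convex_cone hull {y - z | y z. y \<in> P \<and> z \<in> {x}}"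
    proof (intro subsetI hull_inc)
      fix b assume "b \<in> ?B"
      then consider v where "v \<in> ?D" "b = v - x" | "b \<in> set us" by blast
      then show "b \<in> {y - z | y z. y \<in> P \<and> z \<in> {x}}"
      proof cases
        case 1
        then have "v \<in> P" using hullP hull_inc[of v ?D convex] by blast
        then show ?thesis using 1 by blast
      next
        case 2
        have "x + (\<Sum>u\<in>set us. (if u = b then 1 else 0) *\<^sub>R u) \<in> P"
          by (rule P_I[OF x_hull]) simp
        then have "x + b \<in> P" using 2 by (simp add: if_distrib[of "\<lambda>c. c *\<^sub>R _"] cong: if_cong)
        moreover have "b = (x + b) - x" by simp
        ultimately show ?thesis by blast
      qed
    qed
  qed
  ultimately show ?thesis by (rule that)
qed

section \<open>Faces and star cones\<close>

lemma star_cone_vertex: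
  assumes "convex Q" "x \<in> Q"
  shows "star_cone {x} Q = {t *\<^sub>R (y - x) | t y. 0 \<le> t \<and> y \<in> Q}"
proof -
  have eq: "{y - z | y z. y \<in> Q \<and> z \<in> {x}} = (\<lambda>y. y - x) ` Q" by blast
  have "convex ((\<lambda>y. y - x) ` Q)"
    using convex_translation_subtract[OF assms(1)] by simp
  then have "convex hull ((\<lambda>y. y - x) ` Q) = (\<lambda>y. y - x) ` Q" by (simp add: hull_same)
  then show ?thesis
    unfolding star_cone_def eq
    using assms(2) by (subst convex_cone_hull_convex_hull_nonempty) auto
qed

lemma convex_cone_star_cone: "convex_cone (star_cone P Q)"
  unfolding star_cone_def by (rule convex_cone_convex_cone_hull)

lemma star_cone_mono: "Q \<subseteq> Q' \<Longrightarrow> star_cone P Q \<subseteq> star_cone P Q'"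
  unfolding star_cone_def by (rule hull_mono) blast

lemma star_coneI:
  assumes "convex Q" "x \<in> Q" "0 < t" "x + t *\<^sub>R u \<in> Q"
  shows "u \<in> star_cone {x} Q"
proof -
  have "u = (1 / t) *\<^sub>R ((x + t *\<^sub>R u) - x)" using assms(3) by simp
  then show ?thesis unfolding star_cone_vertex[OF assms(1,2)]
    using assms(3,4) by (intro CollectI exI[of _ "1 / t"] exI[of _ "x + t *\<^sub>R u"]) auto
qed

lemma diff_in_star_cone: "convex Q \<Longrightarrow> x \<in> Q \<Longrightarrow> y \<in> Q \<Longrightarrow> y - x \<in> star_cone {x} Q"
  using star_coneI[of Q x 1 "y - x"] by simp

text \<open>
  In the direction of a star cone one can move a little without leaving the convex set.  The lemmas
  below use this to translate between faces through \<open>x\<close> and faces of the star cone at \<open>x\<close>.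
\<close>

lemma star_coneE:
  assumes "convex Q" "x \<in> Q" "u \<in> star_cone {x} Q"
  obtains e where "0 < e" "\<And>t. 0 \<le> t \<Longrightarrow> t \<le> e \<Longrightarrow> x + t *\<^sub>R u \<in> Q"
proof -
  obtain s y where s: "0 \<le> s" "y \<in> Q" "u = s *\<^sub>R (y - x)"
    using assms(3) unfolding star_cone_vertex[OF assms(1,2)] by blast
  have "x + t *\<^sub>R u \<in> Q" if "0 \<le> t" "t \<le> 1 / (s + 1)" for t
  proof -
    have "t * s \<le> 1 / (s + 1) * s" using that s(1) by (intro mult_right_mono) auto
    also have "\<dots> \<le> 1" using s(1) by (simp add: divide_simps)
    finally have "(1 - t * s) *\<^sub>R x + (t * s) *\<^sub>R y \<in> Q"
      using convexD_alt[OF assms(1,2) s(2), of "t * s"] that s(1) by simp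
    then show ?thesis unfolding s(3) by (simp add: algebra_simps)
  qed
  then show ?thesis using that[of "1 / (s + 1)"] s(1) by simp
qed

lemma star_cone_Int:
  assumes "convex Q" "convex Q'" "x \<in> Q" "x \<in> Q'"
  shows "star_cone {x} Q \<inter> star_cone {x} Q' = star_cone {x} (Q \<inter> Q')"
proof
  show "star_cone {x} Q \<inter> star_cone {x} Q' \<subseteq> star_cone {x} (Q \<inter> Q')"
  proof
    fix u assume u: "u \<in> star_cone {x} Q \<inter> star_cone {x} Q'"
    obtain e where e: "0 < e" "\<And>t. 0 \<le> t \<Longrightarrow> t \<le> e \<Longrightarrow> x + t *\<^sub>R u \<in> Q"
      using star_coneE[OF assms(1,3)] u by blast
    obtain e' where e': "0 < e'" "\<And>t. 0 \<le> t \<Longrightarrow> t \<le> e' \<Longrightarrow> x + t *\<^sub>R u \<in> Q'"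
      using star_coneE[OF assms(2,4)] u by blast
    have "x + min e e' *\<^sub>R u \<in> Q \<inter> Q'" using e(2)[of "min e e'"] e'(2)[of "min e e'"] e(1) e'(1) by auto
    then show "u \<in> star_cone {x} (Q \<inter> Q')"
      using assms e(1) e'(1) by (intro star_coneI[of _ _ "min e e'"] convex_Int) auto
  qed
qed (use star_cone_mono in blast)

lemma star_cone_face:
  assumes Q: "convex Q" and F: "F face_of Q" "x \<in> F"
  shows "star_cone {x} F face_of star_cone {x} Q"
  unfolding face_of_def
proof (intro conjI ballI impI)
  have FQ: "F \<subseteq> Q" and cF: "convex F" using face_of_imp_subset face_of_imp_convex F(1) by blast+
  have xQ: "x \<in> Q" using FQ F(2) by blast
  show "star_cone {x} F \<subseteq> star_cone {x} Q" using FQ by (rule star_cone_mono)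
  show "convex (star_cone {x} F)" using convex_cone_star_cone[of "{x}" F] by (simp add: convex_cone_def)
  fix a b u assume ab: "a \<in> star_cone {x} Q" "b \<in> star_cone {x} Q"
    and u: "u \<in> star_cone {x} F" "u \<in> open_segment a b"
  obtain e1 where e1: "0 < e1" "\<And>t. 0 \<le> t \<Longrightarrow> t \<le> e1 \<Longrightarrow> x + t *\<^sub>R a \<in> Q"
    using star_coneE[OF Q xQ ab(1)] by blast
  obtain e2 where e2: "0 < e2" "\<And>t. 0 \<le> t \<Longrightarrow> t \<le> e2 \<Longrightarrow> x + t *\<^sub>R b \<in> Q"
    using star_coneE[OF Q xQ ab(2)] by blast
  obtain e3 where e3: "0 < e3" "\<And>t. 0 \<le> t \<Longrightarrow> t \<le> e3 \<Longrightarrow> x + t *\<^sub>R u \<in> F"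
    using star_coneE[OF cF F(2) u(1)] by blast
  define t where "t = min e1 (min e2 e3)"
  have t: "0 < t" "x + t *\<^sub>R a \<in> Q" "x + t *\<^sub>R b \<in> Q" "x + t *\<^sub>R u \<in> F"
    using e1 e2 e3 by (auto simp: t_def)
  obtain s where s: "0 < s" "s < 1" "u = (1 - s) *\<^sub>R a + s *\<^sub>R b" and "a \<noteq> b"
    using u(2) unfolding in_segment by blast
  have "x + t *\<^sub>R u = (1 - s) *\<^sub>R (x + t *\<^sub>R a) + s *\<^sub>R (x + t *\<^sub>R b)"
    unfolding s(3) by (simp add: algebra_simps)
  then have "x + t *\<^sub>R u \<in> open_segment (x + t *\<^sub>R a) (x + t *\<^sub>R b)"
    unfolding in_segment using s(1,2) t(1) \<open>a \<noteq> b\<close> by (intro conjI exI[of _ s]) auto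
  then have "x + t *\<^sub>R a \<in> F" "x + t *\<^sub>R b \<in> F" using face_ofD[OF F(1) _ t(2,3,4)] by blast+
  then show "a \<in> star_cone {x} F" "b \<in> star_cone {x} F"
    using star_coneI[OF cF F(2) t(1)] by blast+
qed

lemma face_of_star_cone:
  assumes Q: "convex Q" "x \<in> Q" and F: "F face_of star_cone {x} Q" "F \<noteq> {}"
  obtains Q' where "Q' face_of Q" "x \<in> Q'" "star_cone {x} Q' = F"
proof -
  define Q' where "Q' = {y \<in> Q. y - x \<in> F}"
  have FC: "convex_cone F" using face_of_convex_cone_imp_convex_cone[OF convex_cone_star_cone F] .
  have cF: "convex F" using FC by (simp add: convex_cone_def)
  have xQ': "x \<in> Q'" using Q(2) convex_cone_contains_0[OF FC] by (simp add: Q'_def)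
  have "Q' = Q \<inter> (+) x ` F"
  proof (intro equalityI subsetI)
    fix y assume "y \<in> Q'"
    then show "y \<in> Q \<inter> (+) x ` F" by (auto simp: Q'_def intro!: image_eqI[of _ _ "y - x"])
  qed (auto simp: Q'_def)
  then have cQ': "convex Q'" using Q(1) cF by (simp add: convex_Int)
  have face: "Q' face_of Q"
    unfolding face_of_def
  proof (intro conjI ballI impI cQ')
    show "Q' \<subseteq> Q" by (auto simp: Q'_def)
    fix a b y assume ab: "a \<in> Q" "b \<in> Q" and y: "y \<in> Q'" "y \<in> open_segment a b"
    have "y - x \<in> open_segment (a - x) (b - x)"
      using y(2) open_segment_translation_eq[of "- x" y a b] by simp
    moreover have "y - x \<in> F" using y(1) by (simp add: Q'_def)
    ultimately have "a - x \<in> F" "b - x \<in> F"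
      using face_ofD[OF F(1)] ab diff_in_star_cone[OF Q] by blast+
    then show "a \<in> Q'" "b \<in> Q'" using ab by (auto simp: Q'_def)
  qed
  have "star_cone {x} Q' = F"
  proof (intro equalityI subsetI)
    fix u assume "u \<in> star_cone {x} Q'"
    then obtain t y where "0 \<le> t" "y \<in> Q'" "u = t *\<^sub>R (y - x)"
      unfolding star_cone_vertex[OF cQ' xQ'] by blast
    then show "u \<in> F" using convex_cone_scaleR[OF FC] by (simp add: Q'_def)
  next
    fix u assume u: "u \<in> F"
    then obtain e where e: "0 < e" "\<And>t. 0 \<le> t \<Longrightarrow> t \<le> e \<Longrightarrow> x + t *\<^sub>R u \<in> Q"
      using star_coneE[OF Q] face_of_imp_subset[OF F(1)] by blast
    have "x + e *\<^sub>R u \<in> Q'" using e convex_cone_scaleR[OF FC _ u, of e] by (simp add: Q'_def)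
    then show "u \<in> star_cone {x} Q'" using star_coneI[OF cQ' xQ' e(1)] by blast
  qed
  then show ?thesis using that face xQ' by blast
qed

text \<open>
  A face through \<open>x\<close> is determined by its star cone: if the cones agree, the segment from \<open>x\<close> to a
  point of \<open>Q\<close> starts inside the face, so its end belongs to the face too.
\<close>

lemma star_cone_face_mono:
  assumes Q: "convex Q" and F: "F face_of Q" "x \<in> F" and sub: "star_cone {x} Q \<subseteq> star_cone {x} F"
  shows "F = Q"
proof (intro equalityI subsetI)
  fix y assume y: "y \<in> Q"
  have FQ: "F \<subseteq> Q" and cF: "convex F" using face_of_imp_subset face_of_imp_convex F(1) by blast+
  have xQ: "x \<in> Q" using FQ F(2) by blast
  obtain e where e: "0 < e" "\<And>t. 0 \<le> t \<Longrightarrow> t \<le> e \<Longrightarrow> x + t *\<^sub>R (y - x) \<in> F"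
    using star_coneE[OF cF F(2)] sub diff_in_star_cone[OF Q xQ y] by blast
  define t where "t = min e (1/2)"
  have t: "0 < t" "t < 1" "x + t *\<^sub>R (y - x) \<in> F" using e by (auto simp: t_def)
  show "y \<in> F"
  proof (cases "y = x")
    case False
    then have "x + t *\<^sub>R (y - x) \<in> open_segment x y"
      unfolding in_segment using t by (intro conjI exI[of _ t]) (auto simp: algebra_simps)
    then show ?thesis using face_ofD[OF F(1) _ xQ y t(3)] by blast
  qed (use F in simp)
qed (use face_of_imp_subset[OF F(1)] in blast)

section \<open>Star fans of a unimodular complex at a vertex\<close>

lemma polyhedral_complex_convex: "polyhedral_complex Y \<Longrightarrow> P \<in> Y \<Longrightarrow> convex P"
  by (auto simp: polyhedral_complex_def pointed_polyhedron_def polyhedron_imp_convex)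

lemma polyhedral_complex_Int:
  "polyhedral_complex Y \<Longrightarrow> P \<in> Y \<Longrightarrow> Q \<in> Y \<Longrightarrow> (P \<inter> Q) face_of P"
  by (auto simp: polyhedral_complex_def)

lemma polyhedral_complex_face:
  "polyhedral_complex Y \<Longrightarrow> P \<in> Y \<Longrightarrow> F face_of P \<Longrightarrow> F \<noteq> {} \<Longrightarrow> F \<in> Y"
  by (auto simp: polyhedral_complex_def)

lemma unimodular_fan_star_fan:
  assumes Y: "unimodular_complex Y" and x: "{x} \<in> Y"
  shows "unimodular_fan (star_fan Y {x})"
proof -
  have pc: "polyhedral_complex Y" using Y by (simp add: unimodular_complex_def)
  note conv = polyhedral_complex_convex[OF pc]
  have starE: thesis if "\<sigma> \<in> star_fan Y {x}"
    "\<And>Q. Q \<in> Y \<Longrightarrow> x \<in> Q \<Longrightarrow> \<sigma> = star_cone {x} Q \<Longrightarrow> thesis" for \<sigma> thesis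
    using that unfolding star_fan_def by blast
  have starI: "star_cone {x} Q \<in> star_fan Y {x}" if "Q \<in> Y" "x \<in> Q" for Q
    using that unfolding star_fan_def by blast
  show ?thesis
    unfolding unimodular_fan_def
  proof (intro conjI ballI allI impI)
    have "star_fan Y {x} \<subseteq> star_cone {x} ` Y" unfolding star_fan_def by blast
    moreover have "finite Y" using pc by (simp add: polyhedral_complex_def)
    ultimately show "finite (star_fan Y {x})" by (rule finite_subset[OF _ finite_imageI])
  next
    fix \<sigma> assume "\<sigma> \<in> star_fan Y {x}"
    then obtain Q where Q: "Q \<in> Y" "x \<in> Q" "\<sigma> = star_cone {x} Q" by (rule starE)
    have "{x} face_of Q" using polyhedral_complex_Int[OF pc Q(1) x] Q(2) by simp
    moreover have "unimodular_polyhedron Q" using Y Q(1) by (simp add: unimodular_complex_def)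
    ultimately show "\<exists>B. lattice_part B \<and> \<sigma> = convex_cone hull B"
      using unimodular_star_cone Q(3) by metis
  next
    fix \<sigma> \<tau> assume "\<sigma> \<in> star_fan Y {x}" and \<tau>: "\<tau> face_of \<sigma> \<and> \<tau> \<noteq> {}"
    then obtain Q where Q: "Q \<in> Y" "x \<in> Q" "\<sigma> = star_cone {x} Q" by (elim starE)
    obtain Q' where Q': "Q' face_of Q" "x \<in> Q'" "star_cone {x} Q' = \<tau>"
      using face_of_star_cone[OF conv[OF Q(1)] Q(2)] \<tau> Q(3) by blast
    have "Q' \<in> Y" using polyhedral_complex_face[OF pc Q(1) Q'(1)] Q'(2) by blast
    then show "\<tau> \<in> star_fan Y {x}" using starI Q' by blast
  next
    fix \<sigma> \<tau> assume "\<sigma> \<in> star_fan Y {x}" and \<tau>: "\<tau> \<in> star_fan Y {x}"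
    then obtain Q where Q: "Q \<in> Y" "x \<in> Q" "\<sigma> = star_cone {x} Q" by (elim starE)
    obtain Q' where Q': "Q' \<in> Y" "x \<in> Q'" "\<tau> = star_cone {x} Q'" using \<tau> by (rule starE)
    show "(\<sigma> \<inter> \<tau>) face_of \<sigma>"
      unfolding Q(3) Q'(3) star_cone_Int[OF conv[OF Q(1)] conv[OF Q'(1)] Q(2) Q'(2)]
      using star_cone_face[OF conv[OF Q(1)] polyhedral_complex_Int[OF pc Q(1) Q'(1)]] Q(2) Q'(2) by blast
  qed
qed

section \<open>Star fans at an edge\<close>

lemma span_convex_cone_hull: "span (convex_cone hull S) = span S"
proof
  show "span (convex_cone hull S) \<subseteq> span S"
    by (intro span_minimal convex_cone_hull_subset_span) simp
  show "span S \<subseteq> span (convex_cone hull S)"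
    by (intro span_mono hull_subset)
qed

lemma tangent_eq_span_star_cone:
  assumes "x \<in> P"
  shows "tangent P = span (star_cone {x} P)"
  unfolding star_cone_def span_convex_cone_hull tangent_def
proof
  show "span {y - z | y z. y \<in> P \<and> z \<in> {x}} \<subseteq> span {x - y | x y. x \<in> P \<and> y \<in> P}"
    using assms by (intro span_mono) blast
  show "span {x - y | x y. x \<in> P \<and> y \<in> P} \<subseteq> span {y - z | y z. y \<in> P \<and> z \<in> {x}}"
  proof (intro span_minimal subspace_span subsetI)
    fix d assume "d \<in> {x - y | x y. x \<in> P \<and> y \<in> P}"
    then obtain y z where yz: "y \<in> P" "z \<in> P" "d = (y - x) - (z - x)" by auto
    then have "y - x \<in> span {y - z | y z. y \<in> P \<and> z \<in> {x}}" "z - x \<in> span {y - z | y z. y \<in> P \<and> z \<in> {x}}"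
      by (auto intro!: span_base)
    then show "d \<in> span {y - z | y z. y \<in> P \<and> z \<in> {x}}" unfolding yz(3) by (rule span_diff)
  qed
qed

lemma tangent_singleton [simp]: "tangent {x} = {0}"
  by (auto simp: tangent_def)

text \<open>
  Here \<open>r\<close> is the primitive vector pointing from the vertex \<open>x\<close> along the edge \<open>e\<close>.
\<close>

locale vertex_of_edge =
  fixes Y :: "(real ^ 'n) set set" and x :: "real ^ 'n" and e :: "(real ^ 'n) set" and r :: "real ^ 'n"
  assumes Y: "unimodular_complex Y" and x: "{x} \<in> Y" and e: "e \<in> Y" "x \<in> e"
    and lattice_r: "lattice_part {r}" and star_e: "star_cone {x} e = convex_cone hull {r}"
begin

lemma pc: "polyhedral_complex Y"
  using Y by (simp add: unimodular_complex_def)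

lemmas conv = polyhedral_complex_convex[OF pc]

lemma tangent_e: "tangent e = span {r}"
  unfolding tangent_eq_span_star_cone[OF e(2)] star_e span_convex_cone_hull ..

sublocale fan_with_ray "star_fan Y {x}" r
proof
  show "unimodular_fan (star_fan Y {x})" using Y x by (rule unimodular_fan_star_fan)
  show "lattice_part {r}" by (rule lattice_r)
  show "convex_cone hull {r} \<in> star_fan Y {x}"
    unfolding star_e[symmetric] star_fan_def using e by blast
qed

lemma r_in_star_e: "r \<in> star_cone {x} e"
  unfolding star_e by (rule hull_inc) simp

text \<open>
  If \<open>Q\<close> contains the direction of \<open>e\<close> at \<open>x\<close>, the face \<open>e \<inter> Q\<close> of \<open>e\<close> has the same star cone as
  \<open>e\<close>, so it is \<open>e\<close>.
\<close>

lemma r_in_star_cone_iff: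
  assumes "Q \<in> Y" "x \<in> Q"
  shows "r \<in> star_cone {x} Q \<longleftrightarrow> e \<subseteq> Q"
proof
  assume "e \<subseteq> Q"
  then show "r \<in> star_cone {x} Q" using star_cone_mono r_in_star_e by blast
next
  assume "r \<in> star_cone {x} Q"
  then have "star_cone {x} e \<subseteq> star_cone {x} Q"
    unfolding star_e by (intro hull_minimal convex_cone_star_cone) simp
  then have "star_cone {x} e \<subseteq> star_cone {x} (e \<inter> Q)"
    using star_cone_Int[OF conv[OF e(1)] conv[OF assms(1)] e(2) assms(2)] by blast
  then have "e \<inter> Q = e"
    using star_cone_face_mono[OF conv[OF e(1)] polyhedral_complex_Int[OF pc e(1) assms(1)]] e(2) assms(2)
    by blast
  then show "e \<subseteq> Q" by blast
qed

text \<open>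
  Modulo the line of \<open>e\<close>, differences to points of \<open>e\<close> are differences to \<open>x\<close>.  Conversely the star
  cone at \<open>e\<close> contains both directions of that line.
\<close>

lemma star_cone_e:
  assumes "Q \<in> Y" "e \<subseteq> Q"
  shows "star_cone e Q = cone_sum (star_cone {x} Q) (span {r})"
proof
  have hull: "cone_sum (star_cone {x} Q) (span {r}) =
      convex_cone hull ({y - z | y z. y \<in> Q \<and> z \<in> {x}} \<union> span {r})"
    unfolding star_cone_def cone_sum_convex_cone_hull[symmetric]
    by (simp add: hull_same[of convex_cone "span {r}"] convex_cone_span)
  show "star_cone e Q \<subseteq> cone_sum (star_cone {x} Q) (span {r})"
    unfolding star_cone_def[of e]
  proof (rule hull_minimal)
    show "convex_cone (cone_sum (star_cone {x} Q) (span {r}))"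
      unfolding hull by (rule convex_cone_convex_cone_hull)
    show "{y - z | y z. y \<in> Q \<and> z \<in> e} \<subseteq> cone_sum (star_cone {x} Q) (span {r})"
    proof clarify
      fix y z assume yz: "y \<in> Q" "z \<in> e"
      have "y - x \<in> star_cone {x} Q"
        using diff_in_star_cone[OF conv[OF assms(1)]] yz(1) e(2) assms(2) by blast
      moreover have "x - z \<in> span {r}"
        unfolding tangent_e[symmetric] tangent_def using yz(2) e(2) by (intro span_base) blast
      moreover have "y - z = (y - x) + (x - z)" by simp
      ultimately show "y - z \<in> cone_sum (star_cone {x} Q) (span {r})"
        unfolding cone_sum_def by blast
    qed
  qed
  have K: "convex_cone (star_cone e Q)" by (rule convex_cone_star_cone)
  have sub: "star_cone {x} Q \<subseteq> star_cone e Q"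
    unfolding star_cone_def using e(2) by (intro hull_mono) blast
  then have r_mem: "r \<in> star_cone e Q"
    using r_in_star_cone_iff assms e(2) by blast
  \<comment> \<open>Exchanging the roles of \<open>x\<close> and of another point of \<open>e\<close> reverses the direction \<open>r\<close>.\<close>
  obtain s y where s: "0 \<le> s" "y \<in> e" "r = s *\<^sub>R (y - x)"
    using r_in_star_e star_cone_vertex[OF conv[OF e(1)] e(2)] by blast
  have "x - y \<in> star_cone e Q"
    unfolding star_cone_def using s(2) e(2) assms(2) by (intro hull_inc) blast
  from convex_cone_scaleR[OF K s(1) this] have minus_r: "- r \<in> star_cone e Q"
    unfolding s(3) by (simp add: algebra_simps)
  show "cone_sum (star_cone {x} Q) (span {r}) \<subseteq> star_cone e Q"
  proof
    fix u assume "u \<in> cone_sum (star_cone {x} Q) (span {r})"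
    then obtain a t where a: "a \<in> star_cone {x} Q" "u = a + t *\<^sub>R r"
      by (auto simp: cone_sum_def span_singleton)
    have "t *\<^sub>R r \<in> star_cone e Q"
      using convex_cone_scaleR[OF K _ r_mem, of t] convex_cone_scaleR[OF K _ minus_r, of "- t"]
      by (cases "0 \<le> t") auto
    then show "u \<in> star_cone e Q" unfolding a(2) using convex_cone_add[OF K] a(1) sub by blast
  qed
qed

lemma ray_star_eq: "ray_star = star_fan Y e"
proof (intro equalityI subsetI)
  fix \<tau> assume "\<tau> \<in> ray_star"
  then obtain \<sigma> where \<sigma>: "\<sigma> \<in> star_fan Y {x}" "r \<in> \<sigma>" "\<tau> = cone_sum \<sigma> (span {r})"
    unfolding ray_star_def by blast
  then obtain Q where "Q \<in> Y" "x \<in> Q" "\<tau> = cone_sum (star_cone {x} Q) (span {r})" "r \<in> star_cone {x} Q"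
    unfolding star_fan_def by blast
  then show "\<tau> \<in> star_fan Y e"
    using r_in_star_cone_iff star_cone_e unfolding star_fan_def by blast
next
  fix \<tau> assume "\<tau> \<in> star_fan Y e"
  then obtain Q where Q: "Q \<in> Y" "e \<subseteq> Q" "\<tau> = star_cone e Q"
    unfolding star_fan_def by blast
  then have xQ: "x \<in> Q" using e(2) by blast
  then have "star_cone {x} Q \<in> star_fan Y {x}" using Q unfolding star_fan_def by blast
  then show "\<tau> \<in> ray_star"
    using Q r_in_star_cone_iff[OF Q(1) xQ] star_cone_e[OF Q(1,2)] unfolding ray_star_def by blast
qed

text \<open>
  The faces around \<open>e\<close> can be read off from the star fan of \<open>e\<close>, which does not refer to the chosen
  end \<open>x\<close>.  This is what allows the two ends to be compared.
\<close>

lemma star_cone_e_inject: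
  assumes Q: "Q \<in> Y" "e \<subseteq> Q" and Q': "Q' \<in> Y" "e \<subseteq> Q'" and eq: "star_cone e Q = star_cone e Q'"
  shows "Q = Q'"
proof -
  have xQ: "x \<in> Q" "x \<in> Q'" using e(2) Q Q' by blast+
  have mem: "star_cone {x} Q \<in> star_fan Y {x}" "star_cone {x} Q' \<in> star_fan Y {x}"
    using Q Q' xQ unfolding star_fan_def by blast+
  have star_eq: "star_cone {x} Q = star_cone {x} Q'"
    using star_cone_eqD[OF mem(1) _ mem(2)] Q Q' xQ eq r_in_star_cone_iff star_cone_e by blast
  then have Int: "star_cone {x} (Q \<inter> Q') = star_cone {x} Q" "star_cone {x} (Q' \<inter> Q) = star_cone {x} Q'"
    using star_cone_Int[OF conv[OF Q(1)] conv[OF Q'(1)] xQ] by (auto simp: Int_commute)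
  have "Q \<inter> Q' = Q"
    using star_cone_face_mono[OF conv[OF Q(1)] polyhedral_complex_Int[OF pc Q(1) Q'(1)]] xQ Int(1) by blast
  moreover have "Q' \<inter> Q = Q'"
    using star_cone_face_mono[OF conv[OF Q'(1)] polyhedral_complex_Int[OF pc Q'(1) Q(1)]] xQ Int(2) by blast
  ultimately show ?thesis by blast
qed

lemma link_rays_eq: "link_rays Y {x} e = ray_link"
  by (simp add: link_rays_def ray_link_def star_e)

lemma restrict_var_eq: "restrict_var Y {x} e f = subst_var f"
  by (rule ext) (simp add: restrict_var_def subst_var_def star_e tangent_e link_rays_eq)

text \<open>
  If \<open>g\<close> is given on each star cone around \<open>e\<close> by a linear form vanishing on the tangent line of \<open>e\<close>,
  the restriction of its class is the class of the function induced by \<open>g\<close> on the quotient.  The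
  right-hand side is written with forms \<open>m Q\<close> indexed by faces so that \<open>x\<close> no longer occurs in it.
\<close>

lemma chow_restrict_ray_sum:
  assumes m: "\<And>Q. Q \<in> Y \<Longrightarrow> e \<subseteq> Q \<Longrightarrow> linear_form (tangent e) (m Q)"
    and g: "\<And>Q u. Q \<in> Y \<Longrightarrow> e \<subseteq> Q \<Longrightarrow> u \<in> star_cone {x} Q \<Longrightarrow> g u = m Q u"
  shows "chow_restrict Y {x} e (chow_class {0} (star_fan Y {x}) (ray_sum {0} (star_fan Y {x}) g)) =
    chow_class (tangent e) (star_fan Y e)
      (\<Sum>\<rho>\<in>fan_rays (tangent e) (star_fan Y e).
         pconst (m (THE Q. Q \<in> Y \<and> e \<subseteq> Q \<and> star_cone e Q = \<rho>) (ray_gen (tangent e) \<rho>)) * pvar \<rho>)"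
    (is "_ = chow_class _ _ ?q")
proof -
  let ?Q = "\<lambda>\<rho>. THE Q. Q \<in> Y \<and> e \<subseteq> Q \<and> star_cone e Q = \<rho>"
  have gen: "ray_gen (tangent {x}) (star_cone {x} e) = r"
    unfolding star_e tangent_singleton by (rule ray_gen_ray[OF r(1)])
  have gr: "g r = 0"
    using g[OF e(1) subset_refl r_in_star_e] m[OF e(1) subset_refl] unfolding tangent_e linear_form_def
    by (simp add: span_base)
  have r0: "r \<noteq> 0" using lattice_part_nonzero[OF r(1)] by simp
  have coeff: "m (?Q (cone_sum \<rho> (span {r}))) (ray_gen (span {r}) (cone_sum \<rho> (span {r}))) = g (ray_gen {0} \<rho>)"
    if \<rho>: "\<rho> \<in> ray_link" for \<rho>
  proof -
    obtain Q where Q: "Q \<in> Y" "x \<in> Q" "cone_sum \<rho> R = star_cone {x} Q"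
      using link_cone_in_star(4)[OF \<rho>] unfolding star_fan_def by blast
    have eQ: "e \<subseteq> Q" using link_cone_in_star(2)[OF \<rho>] r_in_star_cone_iff[OF Q(1,2)] Q(3) by simp
    have "star_cone e Q = cone_sum \<rho> (span {r})"
      using star_cone_e[OF Q(1) eQ] link_cone_in_star(1)[OF \<rho>] Q(3) by simp
    then have "?Q (cone_sum \<rho> (span {r})) = Q"
      using Q(1) eQ star_cone_e_inject by (intro the_equality) blast+
    moreover have "m Q (ray_gen (span {r}) (cone_sum \<rho> (span {r}))) = m Q (ray_gen {0} \<rho>)"
      using linear_form_ray_gen_star[OF m[OF Q(1) eQ, unfolded tangent_e] \<rho>] .
    moreover have "ray_gen {0} \<rho> \<in> star_cone {x} Q"
    proof -
      obtain w where w: "lattice_part {w, r}" "\<rho> = convex_cone hull {w}" using ray_linkE[OF \<rho>] by blast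
      then have "ray_gen {0} \<rho> = w" using ray_gen_ray lattice_part_subset[OF w(1), of "{w}"] by simp
      then have "ray_gen {0} \<rho> \<in> \<rho>" unfolding w(2) by (simp add: hull_inc)
      then show ?thesis using link_cone_in_star(3)[OF \<rho>] Q(3) by blast
    qed
    ultimately show ?thesis using g[OF Q(1) eQ] by simp
  qed
  show ?thesis
    unfolding tangent_singleton[of x, symmetric]
  proof (rule chow_restrict_class[of "{x}" "\<lambda>y. (r \<bullet> y) / (r \<bullet> r)"])
    show "linear_form (tangent {x}) (\<lambda>y. (r \<bullet> y) / (r \<bullet> r))"
      unfolding linear_form_def
      by (auto intro!: linearI simp: inner_add_right add_divide_distrib)
    show "(r \<bullet> ray_gen (tangent {x}) (star_cone {x} e)) / (r \<bullet> r) = 1"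
      unfolding gen using r0 by simp
  next
    fix f :: "real ^ 'n \<Rightarrow> real"
    show "poly_subst (restrict_var Y {x} e f) (ray_sum (tangent {x}) (star_fan Y {x}) g) = ?q"
      unfolding restrict_var_eq tangent_singleton subst_ray_sum tangent_e ray_star_eq[symmetric] sum_star_rays
      using coeff gr by (intro sum.cong) auto
  next
    fix f i assume "linear_form (tangent {x}) f" "f (ray_gen (tangent {x}) (star_cone {x} e)) = 1"
      "i \<in> chow_ideal (tangent {x}) (star_fan Y {x})"
    then show "poly_subst (restrict_var Y {x} e f) i \<in> chow_ideal (tangent e) (star_fan Y e)"
      unfolding gen restrict_var_eq tangent_e ray_star_eq[symmetric]
      by (intro subst_chow_ideal) simp_all
  qed
qed

end

text \<open>
  The generators of the star cone of \<open>e\<close> are independent and span the tangent line, so there is just one.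
\<close>

lemma vertex_of_edgeI:
  assumes Y: "unimodular_complex Y" and x: "{x} \<in> Y" and e: "e \<in> Y" "x \<in> e" and dim: "aff_dim e = 1"
  obtains r where "vertex_of_edge Y x e r"
proof -
  have pc: "polyhedral_complex Y" using Y by (simp add: unimodular_complex_def)
  have "{x} face_of e" using polyhedral_complex_Int[OF pc e(1) x] e(2) by simp
  moreover have "unimodular_polyhedron e" using Y e(1) by (simp add: unimodular_complex_def)
  ultimately obtain B where B: "lattice_part B" "star_cone {x} e = convex_cone hull B"
    using unimodular_star_cone by blast
  have "{y - z | y z. y \<in> e \<and> z \<in> {x}} = (\<lambda>y. y - x) ` e" by blast
  then have "span B = span ((\<lambda>y. y - x) ` e)"
    using B(2) span_convex_cone_hull[of B] span_convex_cone_hull[of "(\<lambda>y. y - x) ` e"]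
    by (simp add: star_cone_def)
  then have "dim B = dim ((\<lambda>y. y - x) ` e)" by (metis dim_span)
  moreover have "aff_dim e = int (dim ((\<lambda>y. y - x) ` e))"
    using e(2) by (intro aff_dim_eq_dim_subtract hull_inc)
  ultimately have "card B = 1"
    using dim dim_eq_card_independent[OF lattice_part_independent[OF B(1)]] by simp
  then obtain r where "B = {r}" by (auto simp: card_1_singleton_iff)
  then have "vertex_of_edge Y x e r" using Y x e B by unfold_locales auto
  then show ?thesis by (rule that)
qed

section \<open>Directional derivatives of a strictly convex function\<close>

text \<open>
  The one-sided directional derivative.  As it depends only on \<open>f\<close>, it gives a function on the whole
  star fan for which no compatibility between the affine pieces of \<open>f\<close> has to be arranged.
\<close>

definition dir_deriv :: "(real ^ 'n \<Rightarrow> real) \<Rightarrow> real ^ 'n \<Rightarrow> real ^ 'n \<Rightarrow> real" where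
  "dir_deriv f x u = Lim (at_right 0) (\<lambda>t. (f (x + t *\<^sub>R u) - f x) / t)"

text \<open>
  Near \<open>x\<close> the difference quotient is constant along rays that start inside a face.  In particular
  the linear parts of \<open>f\<close> on two faces agree on the intersection of their star cones.
\<close>

lemma dir_deriv_affine:
  assumes Q: "convex Q" "x \<in> Q" and u: "u \<in> star_cone {x} Q" and f: "\<And>y. y \<in> Q \<Longrightarrow> f y = a \<bullet> y + b"
  shows "dir_deriv f x u = a \<bullet> u"
proof -
  obtain e where e: "0 < e" "\<And>t. 0 \<le> t \<Longrightarrow> t \<le> e \<Longrightarrow> x + t *\<^sub>R u \<in> Q"
    using star_coneE[OF Q u] by blast
  have quot: "(f (x + t *\<^sub>R u) - f x) / t = a \<bullet> u" if "t \<in> {0<..<e}" for t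
    using that f[OF e(2)[of t]] f[OF Q(2)] by (simp add: inner_add_right)
  have "eventually (\<lambda>t. t \<in> {0<..<e}) (at_right 0)" using e(1) by (rule eventually_at_right_real)
  then have "eventually (\<lambda>t. (f (x + t *\<^sub>R u) - f x) / t = a \<bullet> u) (at_right 0)"
    by (rule eventually_mono) (rule quot)
  then have "((\<lambda>t. (f (x + t *\<^sub>R u) - f x) / t) \<longlongrightarrow> a \<bullet> u) (at_right 0)"
    by (rule tendsto_eventually)
  then show ?thesis unfolding dir_deriv_def by (intro tendsto_Lim) simp_all
qed

text \<open>
  Around the star cone \<open>\<sigma>\<close> of \<open>P\<close> take the open star of \<open>\<sigma>\<close>, the complement of all star cones of
  faces not containing \<open>P\<close>.  A direction \<open>u\<close> of it outside \<open>\<sigma>\<close> belongs to a face \<open>Q\<close> containing \<open>P\<close>.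
  On \<open>Q\<close>, strict convexity makes \<open>f\<close> minus its affine part on \<open>P\<close> positive close to the relative
  interior of \<open>P\<close>; being affine on \<open>Q\<close> and zero on \<open>P\<close>, this difference is positive on all of the
  segment leading from there to a point in direction \<open>u\<close>, which gives the sign of its slope along \<open>u\<close>.
\<close>

lemma strictly_convex_dir_deriv:
  assumes Y: "unimodular_complex Y" and x: "{x} \<in> Y" and f: "strictly_convex Y f"
  shows "strictly_convex (star_fan Y {x}) (dir_deriv f x)"
proof -
  let ?\<Sigma> = "star_fan Y {x}"
  have pc: "polyhedral_complex Y" using Y by (simp add: unimodular_complex_def)
  note conv = polyhedral_complex_convex[OF pc]
  have fan: "unimodular_fan ?\<Sigma>" using Y x by (rule unimodular_fan_star_fan)
  have closed_star: "closed \<sigma>" if \<sigma>: "\<sigma> \<in> ?\<Sigma>" for \<sigma>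
  proof -
    obtain B where "lattice_part B" "\<sigma> = convex_cone hull B" using unimodular_fan_cone[OF fan \<sigma>] .
    then show ?thesis using closed_convex_cone_hull lattice_part_finite by blast
  qed
  have finite_star: "finite ?\<Sigma>" using fan by (simp add: unimodular_fan_def)
  have starI: "star_cone {x} Q \<in> ?\<Sigma>" if "Q \<in> Y" "x \<in> Q" for Q
    using that unfolding star_fan_def by blast
  have starE: thesis if "\<sigma> \<in> ?\<Sigma>"
    "\<And>Q. Q \<in> Y \<Longrightarrow> x \<in> Q \<Longrightarrow> \<sigma> = star_cone {x} Q \<Longrightarrow> thesis" for \<sigma> thesis
    using that unfolding star_fan_def by blast
  have "\<forall>Q\<in>Y. \<exists>a b. \<forall>y\<in>Q. f y = a \<bullet> y + b" using f unfolding strictly_convex_def by blast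
  then have affine: "\<exists>a b. \<forall>y\<in>Q. f y = a \<bullet> y + b" if "Q \<in> Y" for Q using that by blast
  have linear: "\<exists>a. \<forall>u\<in>\<sigma>. dir_deriv f x u = a \<bullet> u" if \<sigma>: "\<sigma> \<in> ?\<Sigma>" for \<sigma>
  proof -
    obtain Q where Q: "Q \<in> Y" "x \<in> Q" "\<sigma> = star_cone {x} Q" using \<sigma> by (rule starE)
    obtain a b where "\<forall>y\<in>Q. f y = a \<bullet> y + b" using affine[OF Q(1)] by blast
    then show ?thesis using dir_deriv_affine[OF conv[OF Q(1)] Q(2)] Q(3) by blast
  qed
  show ?thesis
    unfolding strictly_convex_def Let_def
  proof (intro conjI ballI)
    have "continuous_on \<sigma> (dir_deriv f x)" if \<sigma>: "\<sigma> \<in> ?\<Sigma>" for \<sigma>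
    proof -
      obtain a where a: "\<And>u. u \<in> \<sigma> \<Longrightarrow> dir_deriv f x u = a \<bullet> u" using linear[OF \<sigma>] by blast
      have "continuous_on \<sigma> (\<lambda>u. a \<bullet> u)" by (intro continuous_intros)
      then show ?thesis by (rule continuous_on_eq) (simp add: a)
    qed
    then show "continuous_on (\<Union>?\<Sigma>) (dir_deriv f x)"
      using continuous_on_closed_Union[OF finite_star, of "\<lambda>\<sigma>. \<sigma>" "dir_deriv f x"] closed_star by simp
  next
    fix \<sigma> assume "\<sigma> \<in> ?\<Sigma>"
    then show "\<exists>a b. \<forall>u\<in>\<sigma>. dir_deriv f x u = a \<bullet> u + b"
      using linear by (metis add.right_neutral)
  next
    fix \<sigma> assume \<sigma>: "\<sigma> \<in> ?\<Sigma>"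
    then obtain P where P: "P \<in> Y" "x \<in> P" "\<sigma> = star_cone {x} P" by (rule starE)
    obtain a b U where ab: "\<And>y. y \<in> P \<Longrightarrow> f y - (a \<bullet> y + b) = 0"
      and U: "openin (top_of_set (\<Union>Y)) U" "rel_interior P \<subseteq> U"
        "\<And>y. y \<in> U - P \<Longrightarrow> f y - (a \<bullet> y + b) > 0"
      using f P(1) unfolding strictly_convex_def Let_def by meson
    have fP: "f y = a \<bullet> y + b" if "y \<in> P" for y using ab[OF that] by simp
    let ?\<C> = "{\<tau> \<in> ?\<Sigma>. \<exists>Q\<in>Y. x \<in> Q \<and> \<tau> = star_cone {x} Q \<and> \<not> P \<subseteq> Q}"
    let ?V = "\<Union>?\<Sigma> - \<Union>?\<C>"
    have "closed (\<Union>?\<C>)" using finite_star closed_star by (intro closed_Union) auto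
    then have open_V: "openin (top_of_set (\<Union>?\<Sigma>)) ?V"
      by (simp add: Diff_eq openin_open_Int open_Compl)
    have rel_V: "rel_interior \<sigma> \<subseteq> ?V"
    proof (rule subsetI, rule DiffI)
      fix u assume u: "u \<in> rel_interior \<sigma>"
      then have u\<sigma>: "u \<in> \<sigma>" using rel_interior_subset by blast
      then show "u \<in> \<Union>?\<Sigma>" using \<sigma> by blast
      show "u \<notin> \<Union>?\<C>"
      proof
        assume "u \<in> \<Union>?\<C>"
        then obtain Q where Q: "Q \<in> Y" "x \<in> Q" "\<not> P \<subseteq> Q" "u \<in> star_cone {x} Q" by blast
        have face: "(P \<inter> Q) face_of P" using polyhedral_complex_Int[OF pc P(1) Q(1)] .
        have xPQ: "x \<in> P \<inter> Q" using P(2) Q(2) by blast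
        have "star_cone {x} (P \<inter> Q) \<noteq> \<sigma>"
          using star_cone_face_mono[OF conv[OF P(1)] face xPQ] P(3) Q(3) by blast
        then have "star_cone {x} (P \<inter> Q) \<inter> rel_interior \<sigma> = {}"
          using star_cone_face[OF conv[OF P(1)] face xPQ] P(3) by (intro face_of_disjoint_rel_interior) simp_all
        moreover have "u \<in> star_cone {x} (P \<inter> Q)"
          using star_cone_Int[OF conv[OF P(1)] conv[OF Q(1)] P(2) Q(2)] u\<sigma> P(3) Q(4) by blast
        ultimately show False using u by blast
      qed
    qed
    have pos: "dir_deriv f x u - (a \<bullet> u + 0) > 0" if u: "u \<in> ?V - \<sigma>" for u
    proof -
      obtain Q where Q: "Q \<in> Y" "x \<in> Q" "u \<in> star_cone {x} Q"
        using u by (blast elim: starE)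
      then have PQ: "P \<subseteq> Q" using u starI[OF Q(1,2)] by blast
      obtain a' b' where f': "\<And>y. y \<in> Q \<Longrightarrow> f y = a' \<bullet> y + b'" using affine[OF Q(1)] by blast
      define h where "h y = (a' - a) \<bullet> y + (b' - b)" for y
      have h: "h y = f y - (a \<bullet> y + b)" if "y \<in> Q" for y
        using f'[OF that] by (simp add: h_def inner_diff_left)
      obtain p where p: "p \<in> rel_interior P"
        using rel_interior_eq_empty[OF conv[OF P(1)]] P(2) by blast
      then have pP: "p \<in> P" using rel_interior_subset by blast
      obtain e where e: "0 < e" "x + e *\<^sub>R u \<in> Q"
        using star_coneE[OF conv[OF Q(1)] Q(2,3)] by (metis order_refl less_imp_le)
      let ?q = "x + e *\<^sub>R u"
      have "?q \<notin> P" using star_coneI[OF conv[OF P(1)] P(2) e(1), of u] u P(3) by blast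
      \<comment> \<open>Points of the segment close enough to \<open>p\<close> lie in \<open>U\<close>.\<close>
      obtain T where T: "open T" "U = \<Union>Y \<inter> T" using U(1) by (auto simp: openin_open)
      have "((\<lambda>s. (1 - s) *\<^sub>R p + s *\<^sub>R ?q) \<longlongrightarrow> (1 - 0) *\<^sub>R p + 0 *\<^sub>R ?q) (at_right 0)"
        by (intro tendsto_intros)
      then have "eventually (\<lambda>s. (1 - s) *\<^sub>R p + s *\<^sub>R ?q \<in> T) (at_right 0)"
        using T p U(2) by (intro topological_tendstoD) auto
      moreover have "eventually (\<lambda>s::real. s \<in> {0<..<1}) (at_right 0)"
        by (rule eventually_at_right_real) simp
      ultimately have "eventually (\<lambda>s. (1 - s) *\<^sub>R p + s *\<^sub>R ?q \<in> T \<and> s \<in> {0<..<1}) (at_right 0)"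
        by (rule eventually_conj)
      then obtain s where s: "(1 - s) *\<^sub>R p + s *\<^sub>R ?q \<in> T" "0 < s" "s < 1"
        by (auto dest!: eventually_happens)
      let ?z = "(1 - s) *\<^sub>R p + s *\<^sub>R ?q"
      have zQ: "?z \<in> Q" using convexD_alt[OF conv[OF Q(1)] _ e(2), of p s] pP PQ s by auto
      have "P \<inter> Q = P" using PQ by blast
      then have "P face_of Q"
        using polyhedral_complex_Int[OF pc Q(1) P(1)] by (simp add: Int_commute)
      have "?z \<notin> P"
      proof
        assume "?z \<in> P"
        moreover have "?z \<in> open_segment p ?q"
          unfolding in_segment using s pP \<open>?q \<notin> P\<close> by blast
        ultimately show False
          using face_ofD[OF \<open>P face_of Q\<close>, of ?z p ?q] pP PQ e(2) \<open>?q \<notin> P\<close> by blast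
      qed
      then have "?z \<in> U - P" using s(1) T(2) zQ Q(1) by blast
      then have "h ?z > 0" using U(3) h[OF zQ] by simp
      moreover have "h ?z = (1 - s) * h p + s * h ?q"
        by (simp add: h_def inner_add_right algebra_simps)
      moreover have "h p = 0" using h[of p] fP[OF pP] pP PQ by auto
      ultimately have "h ?q > 0" using s(2) by (simp add: zero_less_mult_iff)
      moreover have "h ?q = h x + e * ((a' - a) \<bullet> u)"
        by (simp add: h_def inner_add_right)
      moreover have "h x = 0" using h[OF Q(2)] fP[OF P(2)] by simp
      ultimately have "(a' - a) \<bullet> u > 0" using e(1) by (simp add: zero_less_mult_iff)
      then show ?thesis
        using dir_deriv_affine[OF conv[OF Q(1)] Q(2,3) f'] by (simp add: inner_diff_left)
    qed
    have zero: "dir_deriv f x u - (a \<bullet> u + 0) = 0" if "u \<in> \<sigma>" for u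
      using dir_deriv_affine[OF conv[OF P(1)] P(2) _ fP, of u] that P(3) by simp
    show "\<exists>a b. (\<forall>u\<in>\<sigma>. dir_deriv f x u - (a \<bullet> u + b) = 0) \<and>
        (\<exists>U. openin (top_of_set (\<Union>?\<Sigma>)) U \<and> rel_interior \<sigma> \<subseteq> U \<and>
          (\<forall>u\<in>U - \<sigma>. dir_deriv f x u - (a \<bullet> u + b) > 0))"
      using open_V rel_V pos zero by (intro exI[of _ a] exI[of _ 0] exI[of _ ?V] conjI ballI)
  qed
qed

lemma conewise_linear_dir_deriv:
  assumes pc: "polyhedral_complex Y" and f: "strictly_convex Y f"
  shows "conewise_linear {0} (star_fan Y {x}) (dir_deriv f x)"
  unfolding conewise_linear_def
proof
  fix \<sigma> assume "\<sigma> \<in> star_fan Y {x}"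
  then obtain Q where Q: "Q \<in> Y" "x \<in> Q" "\<sigma> = star_cone {x} Q" unfolding star_fan_def by blast
  have "\<forall>Q\<in>Y. \<exists>a b. \<forall>y\<in>Q. f y = a \<bullet> y + b" using f unfolding strictly_convex_def by blast
  then obtain a b where "\<And>y. y \<in> Q \<Longrightarrow> f y = a \<bullet> y + b" using Q(1) by blast
  then have "\<forall>u\<in>\<sigma>. dir_deriv f x u = a \<bullet> u"
    using dir_deriv_affine[OF polyhedral_complex_convex[OF pc Q(1)] Q(2)] Q(3) by blast
  moreover have "linear_form {0} ((\<bullet>) a)"
    by (simp add: linear_form_def bounded_linear.linear bounded_linear_inner_right)
  ultimately show "\<exists>l. linear_form {0} l \<and> (\<forall>u\<in>\<sigma>. dir_deriv f x u = l u)" by blast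
qed

section \<open>The Kaehler class of a strictly convex function\<close>

definition star_class :: "(real ^ 'n) set set \<Rightarrow> (real ^ 'n \<Rightarrow> real) \<Rightarrow> real ^ 'n \<Rightarrow> (real ^ 'n) set rpoly set" where
  "star_class Y f x = chow_class {0} (star_fan Y {x}) (ray_sum {0} (star_fan Y {x}) (dir_deriv f x))"

lemma chow_class_ray_sum_diff_linear:
  assumes "linear_form W l"
  shows "chow_class W \<Sigma> (ray_sum W \<Sigma> (\<lambda>u. g u - l u)) = chow_class W \<Sigma> (ray_sum W \<Sigma> g)"
proof (rule chow_class_eqI)
  have "ray_sum W \<Sigma> (\<lambda>u. g u - l u) - ray_sum W \<Sigma> g = - ray_sum W \<Sigma> l"
    by (simp add: ray_sum_def pconst_diff left_diff_distrib sum_subtractf)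
  then show "ray_sum W \<Sigma> (\<lambda>u. g u - l u) - ray_sum W \<Sigma> g \<in> chow_ideal W \<Sigma>"
    using poly_ring_ideal_closed(4)[OF ideal_chow_ideal[unfolded chow_poly_ring_def] chow_ideal_linear[OF assms]]
    by simp
qed

text \<open>
  Subtracting the linear part of \<open>f\<close> on \<open>e\<close> does not change the class and makes the function vanish
  along \<open>e\<close>.  The resulting expression depends on \<open>e\<close> and \<open>f\<close> but not on the end \<open>x\<close>.
\<close>

lemma chow_restrict_star_class:
  assumes edge: "vertex_of_edge Y x e r"
    and a: "\<And>Q y. Q \<in> Y \<Longrightarrow> y \<in> Q \<Longrightarrow> f y = a Q \<bullet> y + b Q"
  shows "chow_restrict Y {x} e (star_class Y f x) =
    chow_class (tangent e) (star_fan Y e)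
      (\<Sum>\<rho>\<in>fan_rays (tangent e) (star_fan Y e).
         pconst ((a (THE Q. Q \<in> Y \<and> e \<subseteq> Q \<and> star_cone e Q = \<rho>) - a e) \<bullet> ray_gen (tangent e) \<rho>) * pvar \<rho>)"
proof -
  interpret vertex_of_edge Y x e r by (rule edge)
  let ?m = "\<lambda>Q u. (a Q - a e) \<bullet> u"
  have dd: "dir_deriv f x u = a Q \<bullet> u" if "Q \<in> Y" "x \<in> Q" "u \<in> star_cone {x} Q" for Q u
    using dir_deriv_affine[OF conv[OF that(1)] that(2,3) a[OF that(1)]] .
  have l: "linear_form {0} (\<lambda>u. a e \<bullet> u)"
    by (simp add: linear_form_def bounded_linear.linear bounded_linear_inner_right)
  have "star_class Y f x =
      chow_class {0} (star_fan Y {x}) (ray_sum {0} (star_fan Y {x}) (\<lambda>u. dir_deriv f x u - a e \<bullet> u))"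
    unfolding star_class_def by (rule chow_class_ray_sum_diff_linear[OF l, symmetric])
  also have "chow_restrict Y {x} e \<dots> =
    chow_class (tangent e) (star_fan Y e)
      (\<Sum>\<rho>\<in>fan_rays (tangent e) (star_fan Y e).
         pconst (?m (THE Q. Q \<in> Y \<and> e \<subseteq> Q \<and> star_cone e Q = \<rho>) (ray_gen (tangent e) \<rho>)) * pvar \<rho>)"
  proof (rule chow_restrict_ray_sum)
    fix Q assume Q: "Q \<in> Y" "e \<subseteq> Q"
    have xQ: "x \<in> Q" using Q e by blast
    have "r \<in> star_cone {x} Q" using r_in_star_cone_iff[OF Q(1) xQ] Q(2) by simp
    then have "a Q \<bullet> r = a e \<bullet> r"
      using dd[OF Q(1) xQ] dd[OF e r_in_star_e] by simp
    then show "linear_form (tangent e) (?m Q)"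
      unfolding linear_form_def tangent_e
      by (auto simp: span_singleton inner_diff_left bounded_linear.linear bounded_linear_inner_right
          intro!: linear_compose_sub)
    show "dir_deriv f x u - a e \<bullet> u = ?m Q u" if "u \<in> star_cone {x} Q" for u
      using dd[OF Q(1) xQ that] by (simp add: inner_diff_left)
  qed
  finally show ?thesis .
qed

theorem kaehler_class_of_strictly_convex:
  assumes Y: "unimodular_complex Y" and f: "strictly_convex Y f"
  shows "kaehler_class Y (\<lambda>v. star_class Y f (the_elem v))"
proof -
  have pc: "polyhedral_complex Y" using Y by (simp add: unimodular_complex_def)
  have vertex: "\<exists>x. v = {x} \<and> {x} \<in> Y" if "v \<in> vertices Y" for v
    using that by (auto simp: vertices_def finite_part_def aff_dim_eq_0)
  have "\<forall>Q\<in>Y. \<exists>a b. \<forall>y\<in>Q. f y = a \<bullet> y + b" using f unfolding strictly_convex_def by blast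
  then obtain a b where ab: "\<And>Q y. Q \<in> Y \<Longrightarrow> y \<in> Q \<Longrightarrow> f y = a Q \<bullet> y + b Q" by metis
  show ?thesis
    unfolding kaehler_class_def
  proof (intro conjI ballI impI)
    fix v assume "v \<in> vertices Y"
    then obtain x where v: "v = {x}" "{x} \<in> Y" using vertex by blast
    show "star_class Y f (the_elem v) \<in> H2 Y v"
      unfolding v(1) star_class_def H2_def tangent_singleton the_elem_eq by (rule chow_class_in_group1)
    show "ample (tangent v) (star_fan Y v) (star_class Y f (the_elem v))"
      unfolding v(1) star_class_def ample_def tangent_singleton the_elem_eq
    proof (rule conjI[OF chow_class_in_group1], rule exI[of _ "dir_deriv f x"], intro conjI)
      show "conewise_linear {0} (star_fan Y {x}) (dir_deriv f x)"
        using pc f by (rule conewise_linear_dir_deriv)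
      show "strictly_convex (star_fan Y {x}) (dir_deriv f x)"
        using Y v(2) f by (rule strictly_convex_dir_deriv)
    qed (rule refl)
  next
    fix e u v assume "e \<in> edges Y" and uv: "u \<in> vertices Y" "v \<in> vertices Y"
      and sub: "u \<subseteq> e \<and> v \<subseteq> e \<and> u \<noteq> v"
    obtain x where x: "u = {x}" "{x} \<in> Y" using vertex[OF uv(1)] by blast
    obtain y where y: "v = {y}" "{y} \<in> Y" using vertex[OF uv(2)] by blast
    have e: "e \<in> Y" "aff_dim e = 1"
      using \<open>e \<in> edges Y\<close> by (auto simp: edges_def finite_part_def)
    have in_e: "x \<in> e" "y \<in> e" using sub x y by auto
    obtain r where r: "vertex_of_edge Y x e r" using vertex_of_edgeI[OF Y x(2) e(1) in_e(1) e(2)] .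
    obtain s where s: "vertex_of_edge Y y e s" using vertex_of_edgeI[OF Y y(2) e(1) in_e(2) e(2)] .
    show "chow_restrict Y u e (star_class Y f (the_elem u)) = chow_restrict Y v e (star_class Y f (the_elem v))"
      using chow_restrict_star_class[OF r ab] chow_restrict_star_class[OF s ab] x(1) y(1) by simp
  qed
qed

theorem theorem1p6:
  fixes Y :: "(real ^ 'n) set set" and d :: nat
  assumes "unimodular_complex Y"
    and "smooth_support (\<Union>Y)"
    and "pure_dimension Y d"
    and "is_fan (recession_fan Y)"
    and "quasi_projective Y"
  shows "kaehler (recession_fan Y) (compactification Y)"
proof -
  obtain f where "strictly_convex Y f" using assms(5) unfolding quasi_projective_def by blast
  then have "kaehler_class Y (\<lambda>v. star_class Y f (the_elem v))"
    by (rule kaehler_class_of_strictly_convex[OF assms(1)])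
  moreover have "unimodular_triangulation (recession_fan Y) (compactification Y) Y"
    using assms(1) by (simp add: unimodular_triangulation_def)
  ultimately show ?thesis unfolding kaehler_def by blast
qed

end
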